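(* Let $(m_n)_{n\ge1}$ be a sequence of positive integers with $\lim_{n\to\infty}\frac{m_n}{n}=\infty$. For each $n$, let $A=A(n)$ be an $m_n\times n$ random matrix whose entries are mutually independent standard Gaussian variables, and let $c=c(n)\in\mathbb{R}^n$ be a non-random unit vector. Let $z^*=z^*(n)$ be the optimal objective value of the linear program of maximizing $\langle c,x\rangle$ over $x\in\mathbb{R}^n$ subject to $Ax\le\mathbf{1}$. Then for any constant $\varepsilon>0$, $$\mathbb{P}\big\{1-\varepsilon\leq \sqrt{2\log(m_n/n)}\,z^* \leq 1+\varepsilon\big\}\geq 1-n^{-\omega(1)}.$$ In particular, $\lim_{n\to\infty}\sqrt{2\log(m_n/n)}\,z^*=1$ almost surely.
   Context: "Unit vector" means Euclidean norm one; $\mathbf{1}$ is the vector of all ones and inequalities between vectors are coordinate-wise. The optimal objective value is $z^*=\sup\{\langle c,x\rangle:\ x\in\mathbb{R}^n,\ Ax\le\mathbf{1}\}$ (possibly $+\infty$; the zero vector is always feasible). The matrices $A(n)$, $n\ge1$, are defined on a common probability space. For events $E_n$, "$\mathbb{P}(E_n)\ge 1-n^{-\omega(1)}$" means that for every $C>0$ there is $n_0$ such that $\mathbb{P}(E_n)\ge 1-n^{-C}$ for all $n\ge n_0$. *)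

theory Defs
  imports "HOL-Probability.Probability"
begin

text \<open>
  Since the dimension \<open>n\<close> varies within the statement, a vector of \<open>\<real>\<^sup>n\<close> is represented by a function
  \<open>nat \<Rightarrow> real\<close> of which only the values at \<open>0, \<dots>, n - 1\<close> are used, and an \<open>m \<times> n\<close> matrix by a function
  \<open>nat \<Rightarrow> nat \<Rightarrow> real\<close> (row index first) of which only the values at \<open>i < m\<close>, \<open>j < n\<close> are used.
\<close>

definition inner_n :: "nat \<Rightarrow> (nat \<Rightarrow> real) \<Rightarrow> (nat \<Rightarrow> real) \<Rightarrow> real" where
  "inner_n n x y = (\<Sum>j<n. x j * y j)"

definition lp_feasible :: "nat \<Rightarrow> nat \<Rightarrow> (nat \<Rightarrow> nat \<Rightarrow> real) \<Rightarrow> (nat \<Rightarrow> real) set" where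
  "lp_feasible m n A = {x. \<forall>i<m. inner_n n (A i) x \<le> 1}"

definition lp_value :: "nat \<Rightarrow> nat \<Rightarrow> (nat \<Rightarrow> nat \<Rightarrow> real) \<Rightarrow> (nat \<Rightarrow> real) \<Rightarrow> ereal" where
  "lp_value m n A c = (SUP x\<in>lp_feasible m n A. ereal (inner_n n c x))"

definition standard_gaussian_matrix ::
  "'w measure \<Rightarrow> nat \<Rightarrow> nat \<Rightarrow> (nat \<Rightarrow> nat \<Rightarrow> 'w \<Rightarrow> real) \<Rightarrow> bool" where
  "standard_gaussian_matrix M m n A \<longleftrightarrow>
     (\<forall>i<m. \<forall>j<n. distributed M lborel (A i j) (\<lambda>t. ennreal (std_normal_density t))) \<and>
     prob_space.indep_vars M (\<lambda>_. borel) (\<lambda>(i, j). A i j) ({..<m} \<times> {..<n})"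

text \<open>\<open>\<P>(E\<^sub>n) \<ge> 1 - n\<^bsup>-\<omega>(1)\<^esup>\<close>\<close>

definition superpoly_likely :: "'w measure \<Rightarrow> (nat \<Rightarrow> 'w set) \<Rightarrow> bool" where
  "superpoly_likely M E \<longleftrightarrow>
     (\<forall>C::real. C > 0 \<longrightarrow> (\<exists>n0. \<forall>n\<ge>n0. measure M (E n) \<ge> 1 - real n powr (- C)))"

end

theory Submission
  imports Defs "HOL-Real_Asymp.Real_Asymp"
begin

text \<open>
  Write \<open>\<rho> = m / n\<close> and \<open>L = sqrt (2 ln \<rho>)\<close>. Both bounds rest on the remark that a real vector is an
  integer vector, scaled down, plus a remainder in a small polytope whose vertices are again lattice
  points; the number of lattice points involved is small enough for a union bound over Gaussian tails.

  \<^item> \<open>z* \<le> (1 + \<epsilon>) / L\<close> follows if every unit vector \<open>x\<close> satisfies \<open>\<langle>a\<^sub>i, x\<rangle> \<ge> L / (1 + \<epsilon>)\<close> for some row \<open>a\<^sub>i\<close>.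
    Round \<open>x\<close> to a grid of mesh \<open>\<theta> / sqrt n\<close> with \<open>\<theta> = 1 / sqrt \<rho>\<close>. Each grid point is exceeded by many rows,
    and the remainder lies in a cube, on which \<open>A\<close> is controlled by its values at the sign vectors, so
    that the remainder changes some of these many inner products only slightly.

  \<^item> \<open>z* \<ge> 1 / s'\<close> with \<open>s' = (1 + \<epsilon>) L\<close> follows, by separation, if \<open>s' c\<close> is not of the form \<open>A\<^sup>T y\<close> with
    \<open>y \<ge> 0\<close> and \<open>\<Sum>y \<le> 1\<close>. For such a \<open>y\<close>, Cauchy--Schwarz gives \<open>s' \<le> s + |y|\<^sub>2 sqrt E\<close>, where \<open>E\<close> is the sum of
    the squared excesses of \<open>\<langle>a\<^sub>i, c\<rangle>\<close> over \<open>s = (1 + \<epsilon> / 2) L\<close>, which is a small multiple of \<open>n\<close>. On the other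
    hand \<open>|y|\<^sub>2 = O(L / sqrt n)\<close>: round \<open>y\<close> down to \<open>y = z / k + u\<close> with \<open>k = n / L\<^sup>2\<close>; the integer vector \<open>z\<close> has \<open>\<Sum>z \<le> k\<close>,
    hence is sparse, and \<open>|A\<^sup>T z|\<close> is comparable to \<open>sqrt n |z|\<close> uniformly over all such \<open>z\<close>, while \<open>u\<close> lies in
    the convex hull of the vectors \<open>1\<^sub>S / k\<close> with \<open>|S| \<le> k\<close>.
\<close>

section \<open>Independent standard Gaussian variables\<close>

text \<open>The index set is arbitrary, so that the entries of a matrix, its products with a fixed
  vector on the right (indexed by rows) and on the left (indexed by columns) are all instances and
  share the same tail bounds.\<close>

definition gaussian_family :: "'w measure \<Rightarrow> ('k \<Rightarrow> 'w \<Rightarrow> real) \<Rightarrow> 'k set \<Rightarrow> bool" where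
  "gaussian_family M X K \<longleftrightarrow> prob_space.indep_vars M (\<lambda>_. borel) X K \<and>
     (\<forall>k\<in>K. distributed M lborel (X k) (\<lambda>t. ennreal (std_normal_density t)))"

text \<open>Tilting the normal density by \<open>exp (a * y\<^sup>2)\<close> leaves
  \<open>\<sigma>\<close> times the normal density of variance \<open>1 / (1 - 2 * a)\<close>. The
  Laplace transforms of squares below are read off from this, with \<open>a\<close> positive for
  upper tails and negative for lower tails.\<close>

lemma nn_integral_gauss_exp_square:
  fixes a :: real
  assumes "a < 1/2"
  shows "(\<integral>\<^sup>+y. ennreal (std_normal_density y) * ennreal (exp (a * y\<^sup>2)) \<partial>lborel) = ennreal (1 / sqrt (1 - 2 * a))"
proof -
  define \<sigma> where "\<sigma> = 1 / sqrt (1 - 2 * a)"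
  have pos: "1 - 2 * a > 0" using assms by simp
  have \<sigma>: "\<sigma> > 0" "\<sigma>\<^sup>2 = 1 / (1 - 2 * a)" using pos by (auto simp: \<sigma>_def power_divide)
  have eq: "std_normal_density y * exp (a * y\<^sup>2) = \<sigma> * normal_density 0 \<sigma> y" for y
  proof -
    have "- (y\<^sup>2 / 2) + a * y\<^sup>2 = - (y\<^sup>2 / (2 * \<sigma>\<^sup>2))"
      unfolding \<sigma>(2) using pos by (simp add: field_simps)
    moreover have "sqrt (2 * pi * \<sigma>\<^sup>2) = sqrt (2 * pi) * \<sigma>"
      using \<sigma>(1) by (simp add: real_sqrt_mult)
    ultimately show ?thesis using \<sigma>(1)
      by (simp add: std_normal_density_def normal_density_def flip: exp_add)
  qed
  have "(\<integral>\<^sup>+y. ennreal (std_normal_density y) * ennreal (exp (a * y\<^sup>2)) \<partial>lborel)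
      = (\<integral>\<^sup>+y. ennreal \<sigma> * ennreal (normal_density 0 \<sigma> y) \<partial>lborel)"
    using \<sigma>(1) by (intro nn_integral_cong) (simp add: eq normal_density_nonneg flip: ennreal_mult)
  also have "\<dots> = ennreal \<sigma> * (\<integral>\<^sup>+y. ennreal (normal_density 0 \<sigma> y) \<partial>lborel)"
    by (rule nn_integral_cmult) simp
  also have "(\<integral>\<^sup>+y. ennreal (normal_density 0 \<sigma> y) \<partial>lborel) = ennreal (\<integral>y. normal_density 0 \<sigma> y \<partial>lborel)"
    using \<sigma>(1) by (intro nn_integral_eq_integral) (auto simp: normal_density_nonneg)
  finally show ?thesis using \<sigma>(1) by (simp add: \<sigma>_def)
qed

lemma nn_integral_std_normal: "(\<integral>\<^sup>+y. ennreal (std_normal_density y) \<partial>lborel) = 1"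
  using nn_integral_gauss_exp_square[of 0] by simp

context prob_space
begin

lemma gaussian_family_subset:
  "gaussian_family M X K \<Longrightarrow> J \<subseteq> K \<Longrightarrow> gaussian_family M X J"
  unfolding gaussian_family_def by (auto intro: indep_vars_subset)

lemma gaussian_family_measurable:
  assumes "gaussian_family M X K" "k \<in> K"
  shows "random_variable borel (X k)"
  using assms unfolding gaussian_family_def indep_vars_def by auto

text \<open>Exponential Markov inequality: by independence the expectation of the exponential of the
  sum is a product of factors, each at most \<open>exp \<kappa>\<close>. Since \<open>f\<close> may
  be negative, lower tails are covered too; the tail bounds below differ mainly in the choice of
  \<open>f\<close>.\<close>

lemma gaussian_chernoff:
  fixes f :: "real \<Rightarrow> real" and \<kappa> t :: real
  assumes Y: "gaussian_family M Y I" and I: "finite I" and f[measurable]: "f \<in> borel_measurable borel"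
    and int: "(\<integral>\<^sup>+y. ennreal (std_normal_density y) * ennreal (exp (f y)) \<partial>lborel) \<le> ennreal (exp \<kappa>)"
  shows "prob {\<omega> \<in> space M. t \<le> (\<Sum>i\<in>I. f (Y i \<omega>))} \<le> exp (card I * \<kappa> - t)"
proof -
  have [measurable]: "\<And>i. i \<in> I \<Longrightarrow> random_variable borel (Y i)"
    using gaussian_family_measurable[OF Y] .
  have ind: "indep_vars (\<lambda>_. borel) (\<lambda>i \<omega>. ennreal (exp (f (Y i \<omega>)))) I"
    using Y unfolding gaussian_family_def
    by (intro indep_vars_compose2[where X=Y and Y="\<lambda>_ y. ennreal (exp (f y))"]) auto
  have int1: "(\<integral>\<^sup>+\<omega>. ennreal (exp (f (Y i \<omega>))) \<partial>M) \<le> ennreal (exp \<kappa>)" if "i \<in> I" for i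
  proof -
    have "distributed M lborel (Y i) (\<lambda>t. ennreal (std_normal_density t))"
      using Y that unfolding gaussian_family_def by auto
    from distributed_nn_integral[OF this, of "\<lambda>y. ennreal (exp (f y))"] int show ?thesis by simp
  qed
  have "(\<integral>\<^sup>+\<omega>. (\<Prod>i\<in>I. ennreal (exp (f (Y i \<omega>)))) \<partial>M) = (\<Prod>i\<in>I. \<integral>\<^sup>+\<omega>. ennreal (exp (f (Y i \<omega>))) \<partial>M)"
    by (rule indep_vars_nn_integral[OF I ind]) auto
  also have "\<dots> \<le> (\<Prod>i\<in>I. ennreal (exp \<kappa>))"
    by (intro prod_mono_ennreal int1)
  also have "\<dots> = ennreal (exp (card I * \<kappa>))"
    by (simp add: ennreal_power exp_of_nat_mult)
  finally have E: "(\<integral>\<^sup>+\<omega>. (\<Prod>i\<in>I. ennreal (exp (f (Y i \<omega>)))) \<partial>M) \<le> ennreal (exp (card I * \<kappa>))" .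
  let ?u = "\<lambda>\<omega>. (\<Prod>i\<in>I. ennreal (exp (f (Y i \<omega>))))"
  have u: "?u \<omega> = ennreal (exp (\<Sum>i\<in>I. f (Y i \<omega>)))" for \<omega>
    by (simp add: exp_sum I prod_ennreal)
  have "{\<omega> \<in> space M. t \<le> (\<Sum>i\<in>I. f (Y i \<omega>))} \<subseteq> {\<omega> \<in> space M. 1 \<le> ennreal (exp (- t)) * ?u \<omega>}"
    unfolding u by (auto simp: ennreal_mult[symmetric] exp_add[symmetric] ennreal_le_iff simp flip: ennreal_1)
  then have "emeasure M {\<omega> \<in> space M. t \<le> (\<Sum>i\<in>I. f (Y i \<omega>))}
      \<le> emeasure M {\<omega> \<in> space M. 1 \<le> ennreal (exp (- t)) * ?u \<omega>}"
    by (rule emeasure_mono) measurable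
  also have "\<dots> \<le> ennreal (exp (- t)) * (\<integral>\<^sup>+\<omega>. ?u \<omega> * indicator (space M) \<omega> \<partial>M)"
    by (rule nn_integral_Markov_inequality[where A="space M"]) measurable
  also have "(\<integral>\<^sup>+\<omega>. ?u \<omega> * indicator (space M) \<omega> \<partial>M) = (\<integral>\<^sup>+\<omega>. ?u \<omega> \<partial>M)"
    by (intro nn_integral_cong) (simp add: indicator_def)
  also have "ennreal (exp (- t)) * \<dots> \<le> ennreal (exp (- t)) * ennreal (exp (card I * \<kappa>))"
    by (intro mult_left_mono E) auto
  also have "\<dots> = ennreal (exp (card I * \<kappa> - t))"
    by (simp add: ennreal_mult[symmetric] exp_add[symmetric])
  finally show ?thesis by (simp add: emeasure_eq_measure)
qed

lemma gaussian_linear_combination: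
  assumes X: "gaussian_family M X K" and K: "finite K" and w: "(\<Sum>k\<in>K. (w k)\<^sup>2) = 1"
  shows "distributed M lborel (\<lambda>\<omega>. \<Sum>k\<in>K. w k * X k \<omega>) (\<lambda>t. ennreal (std_normal_density t))"
proof -
  \<comment> \<open>Terms with zero coefficient are dropped first, because a degenerate normal
    variable has no density.\<close>
  define J where "J = {k \<in> K. w k \<noteq> 0}"
  have J: "J \<subseteq> K" "finite J" using K by (auto simp: J_def)
  have sJ: "(\<Sum>k\<in>J. (w k)\<^sup>2) = 1"
    unfolding w[symmetric] using K by (intro sum.mono_neutral_left) (auto simp: J_def)
  then have "J \<noteq> {}" by auto
  have XJ: "gaussian_family M X J" using gaussian_family_subset[OF X J(1)] .
  have "distributed M lborel (\<lambda>\<omega>. \<Sum>k\<in>J. w k * X k \<omega>)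
      (normal_density (\<Sum>k\<in>J. 0) (sqrt (\<Sum>k\<in>J. \<bar>w k\<bar>\<^sup>2)))"
  proof (rule sum_indep_normal)
    show "indep_vars (\<lambda>i. borel) (\<lambda>k \<omega>. w k * X k \<omega>) J"
      using XJ unfolding gaussian_family_def
      by (intro indep_vars_compose2[where X=X and Y="\<lambda>k x. w k * x"]) auto
    fix k assume k: "k \<in> J"
    show "0 < \<bar>w k\<bar>" using k by (simp add: J_def)
    have "distributed M lborel (X k) (\<lambda>t. ennreal (normal_density 0 1 t))"
      using XJ k unfolding gaussian_family_def by auto
    from normal_density_affine[OF this, of "w k" 0] k
    show "distributed M lborel (\<lambda>\<omega>. w k * X k \<omega>) (normal_density 0 \<bar>w k\<bar>)"
      by (simp add: J_def)
  qed (use J \<open>J \<noteq> {}\<close> in auto)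
  moreover have "(\<Sum>k\<in>J. w k * X k \<omega>) = (\<Sum>k\<in>K. w k * X k \<omega>)" for \<omega>
    using K by (intro sum.mono_neutral_left) (auto simp: J_def)
  ultimately show ?thesis by (simp add: sJ)
qed

text \<open>Restrictions of an independent family to disjoint blocks are independent as vectors,
  hence so are functions of separate blocks. Taking the rows or the columns of a matrix as blocks
  gives the two families used throughout.\<close>

lemma gaussian_family_blocks:
  assumes X: "gaussian_family M X K" and B: "\<And>i. i \<in> I \<Longrightarrow> B i \<subseteq> K" "\<And>i. i \<in> I \<Longrightarrow> finite (B i)"
    and disj: "disjoint_family_on B I" and w: "\<And>i. i \<in> I \<Longrightarrow> (\<Sum>k\<in>B i. (w k)\<^sup>2) = 1"
  shows "gaussian_family M (\<lambda>i \<omega>. \<Sum>k\<in>B i. w k * X k \<omega>) I"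
  unfolding gaussian_family_def
proof (intro conjI ballI)
  have "indep_vars (\<lambda>j. PiM (B j) (\<lambda>_. borel)) (\<lambda>j \<omega>. restrict (\<lambda>i. X i \<omega>) (B j)) I"
    using X B(1) disj unfolding gaussian_family_def by (intro indep_vars_restrict) auto
  then have "indep_vars (\<lambda>_. borel) (\<lambda>j \<omega>. (\<lambda>x. \<Sum>k\<in>B j. w k * x k) (restrict (\<lambda>i. X i \<omega>) (B j))) I"
    by (rule indep_vars_compose2) measurable
  then show "indep_vars (\<lambda>_. borel) (\<lambda>i \<omega>. \<Sum>k\<in>B i. w k * X k \<omega>) I"
    by (simp cong: sum.cong)
  fix i assume "i \<in> I"
  then show "distributed M lborel (\<lambda>\<omega>. \<Sum>k\<in>B i. w k * X k \<omega>) (\<lambda>t. ennreal (std_normal_density t))"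
    using B w by (intro gaussian_linear_combination gaussian_family_subset[OF X]) auto
qed

end

lemma standard_gaussian_matrix_family:
  "standard_gaussian_matrix M m n A \<longleftrightarrow> gaussian_family M (\<lambda>(i, j). A i j) ({..<m} \<times> {..<n})"
  unfolding standard_gaussian_matrix_def gaussian_family_def by auto

text \<open>The density decreases on the unit interval to the right of \<open>s\<close>, and
  \<open>sqrt (2 * pi) \<le> 3\<close>. Integrated over that interval this bounds the tail
  probability from below; replacing \<open>s\<close> by \<open>s + 1\<close> in the exponent is
  harmless for large \<open>s\<close>.\<close>

lemma std_normal_density_ge_exp:
  assumes "0 \<le> s" "s \<le> y" "y \<le> s + 1"
  shows "exp (- (s + 1)\<^sup>2 / 2) / 3 \<le> std_normal_density y"
proof -
  have "2 * pi \<le> 3\<^sup>2" using pi_less_4 by simp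
  then have "sqrt (2 * pi) \<le> 3" by (intro real_le_lsqrt) auto
  then have "1 / 3 \<le> 1 / sqrt (2 * pi)" by (intro divide_left_mono) auto
  moreover have "y\<^sup>2 \<le> (s + 1)\<^sup>2" using assms by (intro power_mono) auto
  ultimately have "(1 / 3) * exp (- (s + 1)\<^sup>2 / 2) \<le> (1 / sqrt (2 * pi)) * exp (- y\<^sup>2 / 2)"
    by (intro mult_mono) auto
  then show ?thesis by (simp add: std_normal_density_def)
qed

lemma sqrt_eq_exp_ln: "0 < x \<Longrightarrow> sqrt x = exp (ln x / 2)"
  by (simp add: powr_half_sqrt[symmetric] powr_def)

section \<open>Rows and columns of a Gaussian matrix, and Chernoff tail bounds\<close>

context prob_space
begin

lemma gaussian_matrix_rows:
  assumes A: "standard_gaussian_matrix M m n A" and c: "(\<Sum>j<n. (c j)\<^sup>2) = 1"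
  shows "gaussian_family M (\<lambda>i \<omega>. \<Sum>j<n. A i j \<omega> * c j) {..<m}"
proof -
  have "gaussian_family M (\<lambda>i \<omega>. \<Sum>k\<in>{i} \<times> {..<n}. c (snd k) * (case k of (i, j) \<Rightarrow> A i j) \<omega>) {..<m}"
    using A unfolding standard_gaussian_matrix_family
    by (rule gaussian_family_blocks) (auto simp: disjoint_family_on_def c sum.cartesian_product')
  then show ?thesis by (simp add: sum.cartesian_product' mult.commute)
qed

lemma gaussian_matrix_columns:
  assumes A: "standard_gaussian_matrix M m n A" and c: "(\<Sum>i<m. (c i)\<^sup>2) = 1"
  shows "gaussian_family M (\<lambda>j \<omega>. \<Sum>i<m. c i * A i j \<omega>) {..<n}"
proof -
  have "gaussian_family M (\<lambda>j \<omega>. \<Sum>k\<in>{..<m} \<times> {j}. c (fst k) * (case k of (i, j) \<Rightarrow> A i j) \<omega>) {..<n}"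
    using A unfolding standard_gaussian_matrix_family
    by (rule gaussian_family_blocks) (auto simp: disjoint_family_on_def c sum.cartesian_product')
  then show ?thesis by (simp add: sum.cartesian_product')
qed

text \<open>Chernoff bound with \<open>f y = y\<^sup>2 / 4\<close>, whose exponential moment is
  \<open>sqrt 2\<close>. The threshold 16 is large enough for the rate 3 to beat the number of
  vectors in the later union bounds.\<close>

lemma gaussian_sum_squares_upper:
  assumes Y: "gaussian_family M Y I" "finite I"
  shows "prob {\<omega> \<in> space M. 16 * real (card I) \<le> (\<Sum>i\<in>I. (Y i \<omega>)\<^sup>2)} \<le> exp (- 3 * real (card I))"
proof -
  have "1 / sqrt (1 - 2 * (1/4)) = sqrt 2"
    by (simp add: real_sqrt_divide)
  also have "\<dots> = exp (ln 2 / 2)"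
    by (simp add: sqrt_eq_exp_ln)
  finally have e: "1 / sqrt (1 - 2 * (1/4)) = exp (ln 2 / 2 :: real)" .
  have eq: "(4 * real (card I) \<le> (\<Sum>i\<in>I. 1/4 * (Y i \<omega>)\<^sup>2)) = (16 * real (card I) \<le> (\<Sum>i\<in>I. (Y i \<omega>)\<^sup>2))" for \<omega>
    unfolding sum_distrib_left[symmetric] by linarith
  have "prob {\<omega> \<in> space M. 4 * real (card I) \<le> (\<Sum>i\<in>I. 1/4 * (Y i \<omega>)\<^sup>2)} \<le> exp (card I * (ln 2 / 2) - 4 * real (card I))"
    using nn_integral_gauss_exp_square[of "1/4"] e by (intro gaussian_chernoff Y) auto
  also have "exp (card I * (ln 2 / 2) - 4 * real (card I)) \<le> exp (- 3 * real (card I))"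
    using mult_left_mono[OF ln2_le_25_over_36, of "card I"] by (simp add: field_simps)
  finally show ?thesis unfolding eq by simp
qed

text \<open>Chernoff bound with \<open>f y = - 128 * y\<^sup>2\<close>, whose exponential moment is
  \<open>1 / sqrt 257\<close>. The threshold \<open>1 / 256\<close> is so small that the rate 2
  beats a union bound over \<open>exp n\<close> lattice points.\<close>

lemma gaussian_sum_squares_lower:
  assumes Y: "gaussian_family M Y I" "finite I"
  shows "prob {\<omega> \<in> space M. (\<Sum>i\<in>I. (Y i \<omega>)\<^sup>2) \<le> card I / 256} \<le> exp (- 2 * real (card I))"
proof -
  have "1 / sqrt 257 = exp (- ln 257 / 2 :: real)"
    by (simp add: sqrt_eq_exp_ln[of 257] exp_minus inverse_eq_divide)
  then have e: "1 / sqrt (1 - 2 * (-128)) = exp (- ln 257 / 2 :: real)" by simp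
  \<comment> \<open>Uses \<open>3 ^ 5 = 243 \<le> 257\<close>.\<close>
  have "exp 5 = (exp 1 :: real) ^ 5" by (simp flip: exp_of_nat_mult)
  also have "\<dots> \<le> 3 ^ 5" using exp_le by (intro power_mono) auto
  finally have "(5::real) \<le> ln 257" by (simp add: ln_ge_iff)
  then have l: "(1/2 - ln 257 / 2) \<le> - (2::real)" by simp
  have eq: "(- (card I / 2) \<le> (\<Sum>i\<in>I. -128 * (Y i \<omega>)\<^sup>2)) = ((\<Sum>i\<in>I. (Y i \<omega>)\<^sup>2) \<le> card I / 256)" for \<omega>
    unfolding sum_distrib_left[symmetric] by linarith
  have "prob {\<omega> \<in> space M. - (card I / 2) \<le> (\<Sum>i\<in>I. -128 * (Y i \<omega>)\<^sup>2)} \<le> exp (card I * (- ln 257 / 2) - (- (card I / 2)))"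
    using nn_integral_gauss_exp_square[of "-128"] e by (intro gaussian_chernoff Y) auto
  also have "exp (card I * (- ln 257 / 2) - (- (card I / 2))) \<le> exp (- 2 * real (card I))"
    using mult_left_mono[OF l, of "card I"] by (simp add: field_simps)
  finally show ?thesis unfolding eq by simp
qed

text \<open>Chernoff bound with \<open>f\<close> minus the indicator of \<open>{s..}\<close>: each
  variable has tail probability at least \<open>q\<close>, and each exceedance costs a factor
  \<open>exp (-1) \<le> 1/2\<close>, so the exponential moment is at most
  \<open>1 - q / 2 \<le> exp (- (q / 2))\<close>.\<close>

lemma gaussian_exceedance_count:
  fixes K :: real
  assumes Y: "gaussian_family M Y I" "finite I" and s: "0 \<le> s"
  shows "prob {\<omega> \<in> space M. card {i \<in> I. s \<le> Y i \<omega>} \<le> K}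
    \<le> exp (K - card I * (exp (- (s + 1)\<^sup>2 / 2) / 6))"
proof -
  define q where "q = exp (- (s + 1)\<^sup>2 / 2) / 3"
  have q: "0 < q" "q \<le> 1"
  proof -
    have "exp (- (s + 1)\<^sup>2 / 2) \<le> 1" by simp
    then show "q \<le> 1" unfolding q_def by linarith
  qed (simp add: q_def)
  let ?f = "\<lambda>y. - indicat_real {s..} y"
  let ?I = "\<integral>\<^sup>+y. ennreal (std_normal_density y) * ennreal (exp (?f y)) \<partial>lborel"
  have "exp (-1) \<le> (1/2::real)" using exp_ge_add_one_self[of 1] by (simp add: exp_minus field_simps)
  then have e: "exp (-1) + 1/2 \<le> (1::real)" by simp
  \<comment> \<open>The loss \<open>q / 2\<close> is spread over the unit interval from
    \<open>s\<close> and added back, so that a pointwise comparison with the density suffices and no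
    subtraction of extended reals is needed under the integral.\<close>
  have "?I + ennreal (q / 2) = ?I + (\<integral>\<^sup>+y. ennreal (q / 2) * indicator {s..s+1} y \<partial>lborel)"
    by (subst nn_integral_cmult_indicator) (auto simp: q_def)
  also have "\<dots> = (\<integral>\<^sup>+y. ennreal (std_normal_density y) * ennreal (exp (?f y)) + ennreal (q / 2) * indicator {s..s+1} y \<partial>lborel)"
    by (rule nn_integral_add[symmetric]) auto
  also have "\<dots> \<le> (\<integral>\<^sup>+y. ennreal (std_normal_density y) \<partial>lborel)"
  proof (rule nn_integral_mono)
    fix y :: real
    have "std_normal_density y * exp (?f y) + q / 2 * indicator {s..s+1} y \<le> std_normal_density y"
    proof (cases "y \<in> {s..s+1}")
      case True
      then have "q / 2 \<le> std_normal_density y / 2"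
        using std_normal_density_ge_exp[OF s, of y] by (simp add: q_def)
      moreover have "std_normal_density y * (exp (-1) + 1/2) \<le> std_normal_density y * 1"
        using e by (intro mult_left_mono) auto
      ultimately show ?thesis using True by (simp add: algebra_simps)
    next
      case False
      have "exp (?f y) \<le> 1" by (simp add: indicator_def)
      then have "std_normal_density y * exp (?f y) \<le> std_normal_density y"
        by (intro mult_left_le) auto
      then show ?thesis using False by simp
    qed
    moreover have "ennreal (std_normal_density y) * ennreal (exp (?f y)) + ennreal (q / 2) * indicator {s..s+1} y
       = ennreal (std_normal_density y * exp (?f y) + q / 2 * indicator {s..s+1} y)"
      using q by (auto simp: indicator_def ennreal_mult ennreal_plus)
    ultimately show "ennreal (std_normal_density y) * ennreal (exp (?f y)) + ennreal (q / 2) * indicator {s..s+1} y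
      \<le> ennreal (std_normal_density y)" by (simp add: ennreal_leI)
  qed
  finally have "?I + ennreal (q / 2) \<le> 1" by (simp only: nn_integral_std_normal)
  then have "?I \<le> 1 - ennreal (q / 2)"
    using ennreal_minus_mono[OF _ order_refl, of "?I + ennreal (q / 2)" 1 "ennreal (q / 2)"] by simp
  also have "\<dots> = ennreal (1 - q / 2)" using q by (simp add: ennreal_minus flip: ennreal_1)
  also have "\<dots> \<le> ennreal (exp (- (q / 2)))"
    using exp_ge_add_one_self[of "- (q / 2)"] by (intro ennreal_leI) auto
  finally have int: "?I \<le> ennreal (exp (- (q / 2)))" .
  have eq: "(- K \<le> (\<Sum>i\<in>I. ?f (Y i \<omega>))) = (card {i \<in> I. s \<le> Y i \<omega>} \<le> K)" for \<omega>
  proof -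
    have "(\<Sum>i\<in>I. indicat_real {s..} (Y i \<omega>)) = card {i \<in> I. s \<le> Y i \<omega>}"
      using Y(2) by (simp add: indicator_def sum.If_cases Int_def)
    then show ?thesis by (simp add: sum_negf)
  qed
  have "prob {\<omega> \<in> space M. - K \<le> (\<Sum>i\<in>I. ?f (Y i \<omega>))} \<le> exp (card I * (- (q / 2)) - (- K))"
    using int by (intro gaussian_chernoff Y) auto
  then show ?thesis unfolding eq by (simp add: q_def algebra_simps)
qed

text \<open>For \<open>y \<ge> s \<ge> 0\<close> one has
  \<open>(y - s)\<^sup>2 \<le> y\<^sup>2 - s\<^sup>2\<close>, so \<open>1/4 \<le> \<alpha>\<close>
  bounds the exponential of a quarter of the squared excess by 1 plus a tilted Gaussian term. The
  integral of that term is the \<open>\<beta>\<close> of the proof; for \<open>\<alpha>\<close> near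
  \<open>1/2\<close> it has nearly the size of the Gaussian tail at \<open>s\<close>.\<close>

lemma gaussian_excess_squares:
  assumes Y: "gaussian_family M Y I" "finite I" and s: "0 \<le> s" and \<alpha>: "1/4 \<le> \<alpha>" "\<alpha> < 1/2"
  shows "prob {\<omega> \<in> space M. t \<le> (\<Sum>i\<in>I. (max 0 (Y i \<omega> - s))\<^sup>2)}
    \<le> exp (card I * (exp (- \<alpha> * s\<^sup>2) / sqrt (1 - 2 * \<alpha>)) - t / 4)"
proof -
  define \<beta> where "\<beta> = exp (- \<alpha> * s\<^sup>2) / sqrt (1 - 2 * \<alpha>)"
  have "\<beta> \<ge> 0" using \<alpha> by (simp add: \<beta>_def)
  let ?f = "\<lambda>y. 1/4 * (max 0 (y - s))\<^sup>2"
  have pt: "exp (?f y) \<le> 1 + exp (- \<alpha> * s\<^sup>2) * exp (\<alpha> * y\<^sup>2)" for y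
  proof (cases "y \<le> s")
    case False
    have "?f y \<le> \<alpha> * (y - s)\<^sup>2" using False \<alpha> by (auto simp: max_def intro!: mult_right_mono)
    also have "\<dots> \<le> \<alpha> * (y\<^sup>2 - s\<^sup>2)"
    proof (rule mult_left_mono)
      have "0 \<le> 2 * s * (y - s)" using s False by simp
      then show "(y - s)\<^sup>2 \<le> y\<^sup>2 - s\<^sup>2" by (simp add: power2_eq_square algebra_simps)
    qed (use \<alpha> in simp)
    finally have "exp (?f y) \<le> exp (- \<alpha> * s\<^sup>2 + \<alpha> * y\<^sup>2)" by (simp add: algebra_simps)
    then show ?thesis by (simp only: exp_add)
  qed (simp add: max_def)
  have "(\<integral>\<^sup>+y. ennreal (std_normal_density y) * ennreal (exp (?f y)) \<partial>lborel) \<le>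
     (\<integral>\<^sup>+y. ennreal (std_normal_density y) + ennreal (exp (- \<alpha> * s\<^sup>2)) * (ennreal (std_normal_density y) * ennreal (exp (\<alpha> * y\<^sup>2))) \<partial>lborel)"
  proof (rule nn_integral_mono)
    fix y :: real
    have "std_normal_density y * exp (?f y) \<le> std_normal_density y * (1 + exp (- \<alpha> * s\<^sup>2) * exp (\<alpha> * y\<^sup>2))"
      by (intro mult_left_mono pt) auto
    then show "ennreal (std_normal_density y) * ennreal (exp (?f y)) \<le>
      ennreal (std_normal_density y) + ennreal (exp (- \<alpha> * s\<^sup>2)) * (ennreal (std_normal_density y) * ennreal (exp (\<alpha> * y\<^sup>2)))"
      by (simp add: algebra_simps flip: ennreal_mult ennreal_plus)
  qed
  also have "\<dots> = 1 + ennreal (exp (- \<alpha> * s\<^sup>2)) * ennreal (1 / sqrt (1 - 2 * \<alpha>))"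
    by (subst nn_integral_add, simp, simp, subst nn_integral_cmult)
       (simp_all only: nn_integral_std_normal nn_integral_gauss_exp_square[OF \<alpha>(2)], simp)
  also have "\<dots> = ennreal (1 + \<beta>)"
    using \<alpha> \<open>\<beta> \<ge> 0\<close> by (simp add: \<beta>_def ennreal_plus flip: ennreal_mult)
  also have "\<dots> \<le> ennreal (exp \<beta>)" by (intro ennreal_leI exp_ge_add_one_self)
  finally have int: "(\<integral>\<^sup>+y. ennreal (std_normal_density y) * ennreal (exp (?f y)) \<partial>lborel) \<le> ennreal (exp \<beta>)" .
  have eq: "(t / 4 \<le> (\<Sum>i\<in>I. ?f (Y i \<omega>))) = (t \<le> (\<Sum>i\<in>I. (max 0 (Y i \<omega> - s))\<^sup>2))" for \<omega>
    unfolding sum_distrib_left[symmetric] by linarith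
  have "prob {\<omega> \<in> space M. t / 4 \<le> (\<Sum>i\<in>I. ?f (Y i \<omega>))} \<le> exp (card I * \<beta> - t / 4)"
    using int by (intro gaussian_chernoff Y) auto
  then show ?thesis unfolding eq by (simp add: \<beta>_def)
qed

text \<open>Union bound over the variables; a single tail is the Chernoff bound for a one-element
  family with \<open>f y = \<alpha> * y\<^sup>2\<close>.\<close>

lemma gaussian_max_tail:
  assumes Y: "gaussian_family M Y I" "finite I" and s: "0 \<le> s" and \<alpha>: "0 \<le> \<alpha>" "\<alpha> < 1/2"
  shows "prob {\<omega> \<in> space M. \<exists>i\<in>I. s \<le> Y i \<omega>} \<le> card I * (exp (- \<alpha> * s\<^sup>2) / sqrt (1 - 2 * \<alpha>))"
proof -
  define \<beta> where "\<beta> = exp (- \<alpha> * s\<^sup>2) / sqrt (1 - 2 * \<alpha>)"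
  have [measurable]: "\<And>i. i \<in> I \<Longrightarrow> random_variable borel (Y i)"
    using gaussian_family_measurable[OF Y(1)] .
  have one: "prob {\<omega> \<in> space M. s \<le> Y i \<omega>} \<le> \<beta>" if i: "i \<in> I" for i
  proof -
    have [measurable]: "random_variable borel (Y i)" using i by measurable
    have "prob {\<omega> \<in> space M. s \<le> Y i \<omega>} \<le> prob {\<omega> \<in> space M. \<alpha> * s\<^sup>2 \<le> (\<Sum>k\<in>{i}. \<alpha> * (Y k \<omega>)\<^sup>2)}"
      using s \<alpha> by (intro finite_measure_mono) (auto intro!: mult_left_mono power_mono)
    also have "\<dots> \<le> exp (card {i} * ln (1 / sqrt (1 - 2 * \<alpha>)) - \<alpha> * s\<^sup>2)"
      using i \<alpha> by (intro gaussian_chernoff gaussian_family_subset[OF Y(1)])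
        (auto simp: nn_integral_gauss_exp_square)
    also have "\<dots> = exp (ln (1 / sqrt (1 - 2 * \<alpha>))) / exp (\<alpha> * s\<^sup>2)" by (simp add: exp_diff)
    also have "exp (ln (1 / sqrt (1 - 2 * \<alpha>))) = 1 / sqrt (1 - 2 * \<alpha>)" using \<alpha> by (intro exp_ln) simp
    also have "\<dots> / exp (\<alpha> * s\<^sup>2) = \<beta>" by (simp add: \<beta>_def exp_minus inverse_eq_divide)
    finally show ?thesis .
  qed
  have "{\<omega> \<in> space M. \<exists>i\<in>I. s \<le> Y i \<omega>} = (\<Union>i\<in>I. {\<omega> \<in> space M. s \<le> Y i \<omega>})" by auto
  also have "prob \<dots> \<le> (\<Sum>i\<in>I. prob {\<omega> \<in> space M. s \<le> Y i \<omega>})"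
    by (rule finite_measure_subadditive_finite) (auto simp: Y(2))
  also have "\<dots> \<le> (\<Sum>i\<in>I. \<beta>)" by (intro sum_mono one)
  finally show ?thesis by (simp add: \<beta>_def)
qed

end

section \<open>Lattice points and rounding\<close>

lemma inner_le_L2_set: "(\<Sum>i\<in>I. f i * g i) \<le> L2_set f I * L2_set g I"
proof -
  have "(\<Sum>i\<in>I. f i * g i) \<le> (\<Sum>i\<in>I. \<bar>f i\<bar> * \<bar>g i\<bar>)"
    by (intro sum_mono) (simp flip: abs_mult)
  also have "\<dots> \<le> L2_set f I * L2_set g I" by (rule L2_set_mult_ineq)
  finally show ?thesis .
qed

lemma L2_set_power2: "(L2_set f I)\<^sup>2 = (\<Sum>i\<in>I. (f i)\<^sup>2)"
  by (simp add: L2_set_def sum_nonneg)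

lemma L2_set_cmult: "L2_set (\<lambda>i. c * f i) I = \<bar>c\<bar> * L2_set f I"
  by (simp add: L2_set_def power_mult_distrib real_sqrt_mult flip: sum_distrib_left)

lemma sum_geometric_abs:
  fixes x :: real
  assumes "0 \<le> x" "x < 1"
  shows "(\<Sum>a\<in>{- int b..int b}. x ^ nat \<bar>a\<bar>) \<le> 1 + 2 * (x / (1 - x))"
proof -
  have "(\<Sum>a\<in>{- int b..int b}. x ^ nat \<bar>a\<bar>) = 1 + 2 * (x * (1 - x ^ b) / (1 - x))"
  proof (induction b)
    case (Suc b)
    have "{- int (Suc b)..int (Suc b)} = insert (- int (Suc b)) (insert (int (Suc b)) {- int b..int b})" by auto
    then have "(\<Sum>a\<in>{- int (Suc b)..int (Suc b)}. x ^ nat \<bar>a\<bar>) = 2 * x ^ Suc b + (\<Sum>a\<in>{- int b..int b}. x ^ nat \<bar>a\<bar>)"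
      by (simp add: nat_add_distrib)
    also have "\<dots> = 1 + 2 * (x * (1 - x ^ Suc b) / (1 - x))"
      unfolding Suc.IH using assms by (simp add: field_simps)
    finally show ?case .
  qed auto
  also have "\<dots> \<le> 1 + 2 * (x / (1 - x))"
    using assms by (auto intro!: divide_right_mono mult_left_le)
  finally show ?thesis .
qed

text \<open>The indicator of \<open>|z|_1 \<le> N\<close> is at most
  \<open>exp (t * (N - |z|_1))\<close>, and the sum of the latter over the box factorises into
  geometric series. The box makes the set finite while the estimate is uniform in \<open>b\<close>;
  the parameter \<open>t\<close> is tuned at each application.\<close>

lemma card_bounded_integer_vectors:
  fixes t N :: real
  assumes I: "finite I" and t: "0 < t"
  shows "card {z \<in> PiE I (\<lambda>_. {- int b..int b}). (\<Sum>i\<in>I. real_of_int \<bar>z i\<bar>) \<le> N}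
    \<le> exp (t * N) * (1 + 2 / (exp t - 1)) ^ card I"
proof -
  let ?P = "PiE I (\<lambda>_. {- int b..int b})"
  let ?F = "{z \<in> ?P. (\<Sum>i\<in>I. real_of_int \<bar>z i\<bar>) \<le> N}"
  have fin: "finite ?P" using I by (intro finite_PiE) auto
  have "card ?F * exp (- t * N) = (\<Sum>z\<in>?F. exp (- t * N))" by simp
  also have "\<dots> \<le> (\<Sum>z\<in>?F. exp (- t * (\<Sum>i\<in>I. real_of_int \<bar>z i\<bar>)))"
    using t by (intro sum_mono) auto
  also have "\<dots> \<le> (\<Sum>z\<in>?P. exp (- t * (\<Sum>i\<in>I. real_of_int \<bar>z i\<bar>)))"
    using fin by (intro sum_mono2) auto
  also have "\<dots> = (\<Sum>z\<in>?P. \<Prod>i\<in>I. exp (- t) ^ nat \<bar>z i\<bar>)"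
  proof (rule sum.cong)
    fix z
    have "- t * (\<Sum>i\<in>I. real_of_int \<bar>z i\<bar>) = (\<Sum>i\<in>I. real (nat \<bar>z i\<bar>) * - t)"
      by (simp add: sum_distrib_left mult.commute)
    then show "exp (- t * (\<Sum>i\<in>I. real_of_int \<bar>z i\<bar>)) = (\<Prod>i\<in>I. exp (- t) ^ nat \<bar>z i\<bar>)"
      using I by (simp only: exp_sum exp_of_nat_mult)
  qed simp
  also have "\<dots> = (\<Prod>i\<in>I. \<Sum>a\<in>{- int b..int b}. exp (- t) ^ nat \<bar>a\<bar>)"
    using I by (intro prod_sum_PiE[symmetric]) auto
  also have "\<dots> \<le> (\<Prod>i\<in>I. 1 + 2 * (exp (- t) / (1 - exp (- t))))"
    using t by (intro prod_mono conjI sum_geometric_abs sum_nonneg) auto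
  also have "exp (- t) / (1 - exp (- t)) = 1 / (exp t - 1)"
    using t by (simp add: exp_minus field_simps)
  finally have "card ?F * exp (- t * N) \<le> (1 + 2 / (exp t - 1)) ^ card I" by simp
  then show ?thesis by (simp add: exp_minus field_simps)
qed

text \<open>A norm is convex, so on a cube it is largest at a vertex. Concretely, for the image
  \<open>y\<close> of \<open>u\<close>, the square of \<open>|y|\<close> is the pairing of
  \<open>u\<close> with \<open>v\<close>, the transpose applied to \<open>y\<close>; replacing
  \<open>u\<close> by \<open>\<eta>\<close> times the sign pattern of \<open>v\<close> only
  increases it, and Cauchy-Schwarz cancels one factor \<open>|y|\<close>.\<close>

lemma L2_set_image_cube:
  fixes a :: "'i \<Rightarrow> 'j \<Rightarrow> real"
  assumes J: "finite J" and u: "\<And>j. j \<in> J \<Longrightarrow> \<bar>u j\<bar> \<le> \<eta>" and \<eta>: "0 \<le> \<eta>" and "0 \<le> B"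
    and B: "\<And>\<sigma>. \<sigma> \<in> PiE J (\<lambda>_. {-1, 1}) \<Longrightarrow> L2_set (\<lambda>i. \<Sum>j\<in>J. a i j * \<sigma> j) I \<le> B"
  shows "L2_set (\<lambda>i. \<Sum>j\<in>J. a i j * u j) I \<le> \<eta> * B"
proof -
  define y where "y i = (\<Sum>j\<in>J. a i j * u j)" for i
  define v where "v j = (\<Sum>i\<in>I. y i * a i j)" for j
  define \<sigma> where "\<sigma> = (\<lambda>j\<in>J. if 0 \<le> v j then 1 else -1 :: real)"
  have "(L2_set y I)\<^sup>2 = (\<Sum>i\<in>I. \<Sum>j\<in>J. y i * (a i j * u j))"
    unfolding L2_set_power2 by (simp add: power2_eq_square y_def sum_distrib_left)
  also have "\<dots> = (\<Sum>j\<in>J. u j * v j)"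
    by (subst sum.swap) (simp add: v_def sum_distrib_left mult_ac)
  also have "\<dots> \<le> (\<Sum>j\<in>J. \<eta> * (\<sigma> j * v j))"
  proof (rule sum_mono)
    fix j assume j: "j \<in> J"
    have "u j * v j \<le> \<bar>u j\<bar> * \<bar>v j\<bar>" by (simp flip: abs_mult)
    also have "\<dots> \<le> \<eta> * \<bar>v j\<bar>" using u[OF j] by (intro mult_right_mono) auto
    also have "\<bar>v j\<bar> = \<sigma> j * v j" using j by (simp add: \<sigma>_def)
    finally show "u j * v j \<le> \<eta> * (\<sigma> j * v j)" .
  qed
  also have "\<dots> = \<eta> * (\<Sum>i\<in>I. y i * (\<Sum>j\<in>J. a i j * \<sigma> j))"
    unfolding v_def sum_distrib_left by (subst sum.swap) (simp add: mult_ac)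
  also have "\<dots> \<le> \<eta> * (L2_set y I * L2_set (\<lambda>i. \<Sum>j\<in>J. a i j * \<sigma> j) I)"
    using \<eta> by (intro mult_left_mono inner_le_L2_set)
  also have "\<dots> \<le> \<eta> * (L2_set y I * B)"
    using \<eta> by (intro mult_left_mono B) (auto simp: \<sigma>_def split: if_splits)
  finally have *: "L2_set y I * L2_set y I \<le> L2_set y I * (\<eta> * B)"
    by (simp add: power2_eq_square mult_ac)
  have "L2_set y I \<le> \<eta> * B"
  proof (cases "L2_set y I = 0")
    case False
    then have "0 < L2_set y I" using L2_set_nonneg[of y I] by linarith
    then show ?thesis using * by simp
  qed (use assms in simp)
  then show ?thesis by (simp add: y_def[abs_def])
qed

text \<open>The vectors \<open>1_S / k\<close> with \<open>|S| \<le> k\<close> include all vertices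
  of the polytope of admissible \<open>u\<close>, so a linear functional is maximal at one of them.
  \<open>S\<close> is taken with maximal sum of \<open>v\<close>, and optimality is certified by a
  dual multiplier \<open>\<theta>\<close>.\<close>

lemma capped_simplex_max:
  fixes u v :: "'i \<Rightarrow> real"
  assumes I: "finite I" and k: "0 < k" and u: "\<And>i. i \<in> I \<Longrightarrow> 0 \<le> u i" "\<And>i. i \<in> I \<Longrightarrow> u i \<le> 1 / real k"
    and u1: "(\<Sum>i\<in>I. u i) \<le> 1"
  obtains S where "S \<subseteq> I" "card S \<le> k" "(\<Sum>i\<in>I. u i * v i) \<le> (\<Sum>i\<in>S. v i) / real k"
proof -
  define F where "F = {S. S \<subseteq> I \<and> card S \<le> k}"
  have "finite F" "F \<noteq> {}" unfolding F_def using I by (auto intro!: exI[of _ "{}"])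
  then obtain S where S: "S \<in> F" and max: "\<And>T. T \<in> F \<Longrightarrow> (\<Sum>i\<in>T. v i) \<le> (\<Sum>i\<in>S. v i)"
    using Max_in[of "(\<lambda>T. \<Sum>i\<in>T. v i) ` F"] Max_ge[of "(\<lambda>T. \<Sum>i\<in>T. v i) ` F"] by fastforce
  have SI: "S \<subseteq> I" "card S \<le> k" and fS: "finite S" using S I by (auto simp: F_def intro: finite_subset)
  have pos: "0 \<le> v i" if "i \<in> S" for i
  proof -
    have "S - {i} \<in> F" using SI fS that by (auto simp: F_def)
    from max[OF this] show ?thesis using that fS by (simp add: sum_diff1)
  qed
  \<comment> \<open>\<open>\<theta>\<close> is the multiplier of the constraint that
    \<open>u\<close> sums to at most 1: a threshold separating the values of \<open>v\<close> on
    \<open>S\<close> from those outside, and zero unless \<open>S\<close> is full. If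
    \<open>S\<close> is full, exchanging one element shows that nothing outside exceeds the minimum
    on \<open>S\<close>; otherwise adding an element shows that nothing outside is positive.\<close>
  obtain \<theta> where \<theta>: "0 \<le> \<theta>" "\<And>i. i \<in> S \<Longrightarrow> \<theta> \<le> v i" "\<And>i. i \<in> I - S \<Longrightarrow> v i \<le> \<theta>" "card S = k \<or> \<theta> = 0"
  proof (cases "card S = k")
    case True
    then have ne: "S \<noteq> {}" using k by auto
    show ?thesis
    proof (rule that)
      show "0 \<le> Min (v ` S)" using ne fS pos by simp
      show "Min (v ` S) \<le> v i" if "i \<in> S" for i using that fS by simp
      show "v i \<le> Min (v ` S)" if i: "i \<in> I - S" for i
      proof -
        have "v i \<le> v j" if j: "j \<in> S" for j
        proof -
          have "insert i (S - {j}) \<in> F" using SI fS i True card_Suc_Diff1[OF fS j] by (auto simp: F_def card_insert_if)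
          from max[OF this] show ?thesis using i j fS by (simp add: sum_diff1)
        qed
        then show ?thesis using ne fS by simp
      qed
    qed (use True in simp)
  next
    case False
    show ?thesis
    proof (rule that[of 0])
      show "v i \<le> 0" if i: "i \<in> I - S" for i
      proof -
        have "insert i S \<in> F" using SI fS i False by (auto simp: F_def)
        from max[OF this] show ?thesis using i fS by simp
      qed
    qed (use pos in auto)
  qed
  have split: "(\<Sum>i\<in>I. f i) = (\<Sum>i\<in>S. f i) + (\<Sum>i\<in>I - S. f i)" for f :: "'i \<Rightarrow> real"
    using sum.subset_diff[OF SI(1) I, of f] by simp
  have "(\<Sum>i\<in>S. (u i - 1 / k) * v i) \<le> (\<Sum>i\<in>S. (u i - 1 / k) * \<theta>)"
    using u(2) \<theta>(2) SI by (intro sum_mono mult_left_mono_neg) auto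
  moreover have "(\<Sum>i\<in>I - S. u i * v i) \<le> (\<Sum>i\<in>I - S. u i * \<theta>)"
    using u(1) \<theta>(3) by (intro sum_mono mult_left_mono) auto
  moreover have "(\<Sum>i\<in>S. (u i - 1 / k) * \<theta>) + (\<Sum>i\<in>I - S. u i * \<theta>) = \<theta> * ((\<Sum>i\<in>I. u i) - card S / k)"
    by (simp add: split[of u] sum_subtractf algebra_simps flip: sum_distrib_left sum_distrib_right)
  \<comment> \<open>Complementary slackness: either \<open>card S / k = 1\<close> bounds the sum of
    \<open>u\<close>, or \<open>\<theta> = 0\<close>.\<close>
  moreover have "\<theta> * ((\<Sum>i\<in>I. u i) - card S / k) \<le> 0"
    using \<theta>(1,4) u1 k by (auto simp: mult_nonneg_nonpos)
  moreover have "(\<Sum>i\<in>S. (u i - 1 / k) * v i) = (\<Sum>i\<in>S. u i * v i) - (\<Sum>i\<in>S. v i) / k"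
    by (simp add: left_diff_distrib sum_subtractf sum_divide_distrib)
  ultimately have "(\<Sum>i\<in>I. u i * v i) \<le> (\<Sum>i\<in>S. v i) / k"
    by (simp add: split[of "\<lambda>i. u i * v i"])
  then show thesis using that SI by blast
qed

text \<open>The same duality as for the cube: the squared norm of the image \<open>y\<close> is
  linear in \<open>u\<close> once \<open>y\<close> is held fixed in one factor, and the vertex that
  maximises this functional replaces \<open>u\<close>.\<close>

lemma L2_set_image_capped_simplex:
  fixes a :: "'i \<Rightarrow> 'j \<Rightarrow> real"
  assumes I: "finite I" and k: "0 < k" and u: "\<And>i. i \<in> I \<Longrightarrow> 0 \<le> u i" "\<And>i. i \<in> I \<Longrightarrow> u i \<le> 1 / real k"
    and u1: "(\<Sum>i\<in>I. u i) \<le> 1" and B0: "0 \<le> B"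
    and B: "\<And>S. S \<subseteq> I \<Longrightarrow> card S \<le> k \<Longrightarrow> L2_set (\<lambda>j. \<Sum>i\<in>S. a i j) J \<le> B"
  shows "L2_set (\<lambda>j. \<Sum>i\<in>I. u i * a i j) J \<le> B / k"
proof -
  define y where "y j = (\<Sum>i\<in>I. u i * a i j)" for j
  obtain S where S: "S \<subseteq> I" "card S \<le> k"
    "(\<Sum>i\<in>I. u i * (\<Sum>j\<in>J. y j * a i j)) \<le> (\<Sum>i\<in>S. \<Sum>j\<in>J. y j * a i j) / real k"
    by (rule capped_simplex_max[OF I k u u1, where v = "\<lambda>i. \<Sum>j\<in>J. y j * a i j"])
  have "(y j)\<^sup>2 = (\<Sum>i\<in>I. u i * (y j * a i j))" for j
    unfolding power2_eq_square by (subst (2) y_def) (simp add: sum_distrib_left mult_ac)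
  then have "(L2_set y J)\<^sup>2 = (\<Sum>i\<in>I. u i * (\<Sum>j\<in>J. y j * a i j))"
    unfolding L2_set_power2 sum_distrib_left by (subst sum.swap) simp
  also note S(3)
  also have "(\<Sum>i\<in>S. \<Sum>j\<in>J. y j * a i j) = (\<Sum>j\<in>J. y j * (\<Sum>i\<in>S. a i j))"
    by (subst sum.swap) (simp add: sum_distrib_left)
  also have "\<dots> / k \<le> (L2_set y J * L2_set (\<lambda>j. \<Sum>i\<in>S. a i j) J) / k"
    by (intro divide_right_mono inner_le_L2_set) auto
  also have "\<dots> \<le> (L2_set y J * B) / k"
    using S by (intro divide_right_mono mult_left_mono B) auto
  finally have *: "L2_set y J * L2_set y J \<le> L2_set y J * (B / k)"
    by (simp add: power2_eq_square)
  have "L2_set y J \<le> B / k"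
  proof (cases "L2_set y J = 0")
    case False
    then have "0 < L2_set y J" using L2_set_nonneg[of y J] by linarith
    then show ?thesis using * by (metis mult_le_cancel_left_pos)
  qed (use B0 in simp)
  then show ?thesis by (simp add: y_def[abs_def])
qed

section \<open>Deterministic bounds for the linear program\<close>

lemma lp_value_ge:
  "x \<in> lp_feasible m n A \<Longrightarrow> ereal (inner_n n c x) \<le> lp_value m n A c"
  unfolding lp_value_def by (rule SUP_upper)

lemma lp_value_nonneg: "0 \<le> lp_value m n A c"
  using lp_value_ge[of "\<lambda>_. 0" m n A c] by (simp add: lp_feasible_def inner_n_def zero_ereal_def)

text \<open>If a feasible \<open>x\<close> has norm \<open>r\<close>, some row is at least
  \<open>s\<close> on \<open>x / r\<close> but, by feasibility, at most \<open>1 / r\<close>. So the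
  feasible set lies in the ball of radius \<open>1 / s\<close>, and a unit objective cannot exceed
  that radius.\<close>

lemma lp_value_le:
  assumes s: "0 < s" and c: "L2_set c {..<n} = 1"
    and ex: "\<And>x. L2_set x {..<n} = 1 \<Longrightarrow> \<exists>i<m. s \<le> inner_n n (A i) x"
  shows "lp_value m n A c \<le> ereal (1 / s)"
  unfolding lp_value_def
proof (rule SUP_least)
  fix x assume x: "x \<in> lp_feasible m n A"
  define r where "r = L2_set x {..<n}"
  have cx: "inner_n n c x \<le> r" using inner_le_L2_set[of c x "{..<n}"] c by (simp add: inner_n_def r_def)
  have "r \<le> 1 / s"
  proof (cases "r = 0")
    case False
    then have r: "r > 0" using L2_set_nonneg[of x "{..<n}"] unfolding r_def by linarith
    have "L2_set (\<lambda>j. 1 / r * x j) {..<n} = 1" unfolding L2_set_cmult using r by (simp add: r_def)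
    from ex[OF this] obtain i where i: "i < m" "s \<le> inner_n n (A i) (\<lambda>j. 1 / r * x j)" by auto
    have "inner_n n (A i) (\<lambda>j. 1 / r * x j) = inner_n n (A i) x / r"
      by (simp add: inner_n_def sum_divide_distrib)
    also have "\<dots> \<le> 1 / r" using x i r by (simp add: lp_feasible_def divide_right_mono)
    finally have "s \<le> 1 / r" using i by simp
    then show ?thesis using r s by (simp add: field_simps)
  qed (use s in simp)
  then show "ereal (inner_n n c x) \<le> ereal (1 / s)" using cx by simp
qed

text \<open>Pinning the coordinates from \<open>m\<close> on to 0 makes the set a closed subset of a
  product of compact sets, so Tychonoff applies in the function space.\<close>

lemma compact_subsimplex:
  fixes m :: nat
  shows "compact {y :: nat \<Rightarrow> real. (\<forall>i<m. 0 \<le> y i) \<and> (\<forall>i\<ge>m. y i = 0) \<and> (\<Sum>i<m. y i) \<le> 1}"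
proof -
  let ?C = "PiE UNIV (\<lambda>i. if i < m then {0..1} else {0::real})"
  have "compactin (product_topology (\<lambda>_. euclidean) UNIV) ?C"
    unfolding compactin_PiE by auto
  then have C: "compact ?C" by (simp add: euclidean_product_topology)
  have cont: "continuous_on UNIV (\<lambda>y :: nat \<Rightarrow> real. \<Sum>i<m. y i)"
    by (intro continuous_on_sum continuous_on_product_coordinates)
  have "closed {y :: nat \<Rightarrow> real. (\<Sum>i<m. y i) \<le> 1}"
    using closed_Collect_le[OF cont continuous_on_const] .
  with C have "compact (?C \<inter> {y. (\<Sum>i<m. y i) \<le> 1})" by (rule compact_Int_closed)
  moreover have "?C \<inter> {y. (\<Sum>i<m. y i) \<le> 1} =
    {y. (\<forall>i<m. 0 \<le> y i) \<and> (\<forall>i\<ge>m. y i = 0) \<and> (\<Sum>i<m. y i) \<le> 1}" (is "?L = ?R")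
  proof
    show "?R \<subseteq> ?L"
    proof
      fix y assume y: "y \<in> ?R"
      have "y i \<le> 1" if "i < m" for i
        using member_le_sum[of i "{..<m}" y] y that by auto
      then show "y \<in> ?L" using y by auto
    qed
  qed (auto simp: PiE_iff split: if_splits)
  ultimately show ?thesis by simp
qed

text \<open>The point \<open>x\<close> points from the nearest point of the convex hull of the rows and \<open>0\<close> towards \<open>s c\<close>.\<close>

lemma lp_point_if_outside_hull:
  assumes s: "0 < s"
    and out: "\<And>y. \<forall>i<m. 0 \<le> y i \<Longrightarrow> (\<Sum>i<m. y i) \<le> 1 \<Longrightarrow> \<exists>j<n. (\<Sum>i<m. y i * A i j) \<noteq> s * c j"
  obtains x where "x \<in> lp_feasible m n A" "inner_n n c x = 1 / s"
proof -
  define K where "K = {y :: nat \<Rightarrow> real. (\<forall>i<m. 0 \<le> y i) \<and> (\<forall>i\<ge>m. y i = 0) \<and> (\<Sum>i<m. y i) \<le> 1}"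
  define p where "p y j = s * c j - (\<Sum>i<m. y i * A i j)" for y j
  have comp: "compact K" unfolding K_def by (rule compact_subsimplex)
  have 0: "(\<lambda>_. 0) \<in> K" by (simp add: K_def)
  have "continuous_on K (\<lambda>y. \<Sum>j<n. (p y j)\<^sup>2)"
    unfolding p_def by (intro continuous_intros continuous_on_subset[OF continuous_on_product_coordinates]) auto
  then obtain y where y: "y \<in> K" and min: "\<And>y'. y' \<in> K \<Longrightarrow> (\<Sum>j<n. (p y j)\<^sup>2) \<le> (\<Sum>j<n. (p y' j)\<^sup>2)"
    using continuous_attains_inf[OF comp] 0 by blast
  define q where "q = p y"
  \<comment> \<open>Variational inequality for the nearest point: \<open>q\<close> is the residual
    from it to \<open>s c\<close>, and moving a fraction \<open>t\<close> towards \<open>y'\<close>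
    stays in the convex set \<open>K\<close>, so it cannot shorten the residual.\<close>
  have opt: "(\<Sum>j<n. q j * (\<Sum>i<m. (y' i - y i) * A i j)) \<le> 0" if y': "y' \<in> K" for y'
  proof -
    define d where "d j = (\<Sum>i<m. (y' i - y i) * A i j)" for j
    have le: "2 * (\<Sum>j<n. q j * d j) \<le> t * (\<Sum>j<n. (d j)\<^sup>2)" if t: "0 < t" "t \<le> 1" for t
    proof -
      let ?y = "\<lambda>i. y i + t * (y' i - y i)"
      have eq: "?y i = (1 - t) * y i + t * y' i" for i by (simp add: algebra_simps)
      have "(\<Sum>i<m. ?y i) = (1 - t) * (\<Sum>i<m. y i) + t * (\<Sum>i<m. y' i)"
        unfolding eq sum.distrib sum_distrib_left ..
      also have "\<dots> \<le> (1 - t) * 1 + t * 1"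
        using y y' t by (intro add_mono mult_left_mono) (auto simp: K_def)
      finally have "?y \<in> K" using y y' t unfolding K_def by (auto simp: eq)
      from min[OF this] have "(\<Sum>j<n. (q j)\<^sup>2) \<le> (\<Sum>j<n. (p ?y j)\<^sup>2)" by (simp add: q_def)
      have peq: "p ?y j = q j - t * d j" for j
        by (simp add: p_def q_def d_def algebra_simps sum.distrib sum_distrib_left sum_subtractf)
      note \<open>(\<Sum>j<n. (q j)\<^sup>2) \<le> (\<Sum>j<n. (p ?y j)\<^sup>2)\<close>
      also have "(\<Sum>j<n. (p ?y j)\<^sup>2) = (\<Sum>j<n. (q j)\<^sup>2 - 2 * t * (q j * d j) + t\<^sup>2 * (d j)\<^sup>2)"
        unfolding peq by (intro sum.cong refl) (simp add: power2_eq_square algebra_simps)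
      also have "\<dots> = (\<Sum>j<n. (q j)\<^sup>2) - 2 * t * (\<Sum>j<n. q j * d j) + t\<^sup>2 * (\<Sum>j<n. (d j)\<^sup>2)"
        by (simp add: sum.distrib sum_subtractf sum_distrib_left)
      finally have "t * (2 * (\<Sum>j<n. q j * d j)) \<le> t * (t * (\<Sum>j<n. (d j)\<^sup>2))"
        by (simp add: power2_eq_square mult_ac)
      then show ?thesis using t by simp
    qed
    define a where "a = (\<Sum>j<n. q j * d j)"
    define b where "b = (\<Sum>j<n. (d j)\<^sup>2)"
    have "b \<ge> 0" by (simp add: b_def sum_nonneg)
    have "a \<le> 0"
    proof (rule ccontr)
      assume "\<not> a \<le> 0"
      then have a: "a > 0" by simp
      \<comment> \<open>This choice of \<open>t\<close> is admissible and gives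
        \<open>t * b \<le> a\<close>, against \<open>2 * a \<le> t * b\<close>.\<close>
      have "2 * a \<le> min 1 (a / (b + 1)) * b"
        using le[of "min 1 (a / (b + 1))"] a \<open>b \<ge> 0\<close> by (simp add: a_def b_def)
      also have "\<dots> \<le> a / (b + 1) * b" using \<open>b \<ge> 0\<close> by (intro mult_right_mono) auto
      also have "\<dots> \<le> a" using a \<open>b \<ge> 0\<close> by (simp add: field_simps)
      finally show False using a by simp
    qed
    then show ?thesis by (simp add: a_def d_def)
  qed
  define b where "b = (\<Sum>j<n. q j * (\<Sum>i<m. y i * A i j))"
  define cq where "cq = inner_n n c q"
  \<comment> \<open>Being outside the hull enters here: the residual is nonzero, which makes the
    separation by \<open>q\<close> strict.\<close>
  obtain j where j: "j < n" "q j \<noteq> 0"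
    using out[of y] y by (auto simp: K_def q_def p_def)
  then have qpos: "0 < (\<Sum>j<n. (q j)\<^sup>2)" by (intro sum_pos2[of _ j]) auto
  have "(\<Sum>j<n. (q j)\<^sup>2) = (\<Sum>j<n. q j * (s * c j - (\<Sum>i<m. y i * A i j)))"
    by (simp add: power2_eq_square q_def p_def)
  also have "\<dots> = s * cq - b"
    by (simp add: cq_def b_def inner_n_def right_diff_distrib sum_subtractf sum_distrib_left mult_ac)
  finally have less: "b < s * cq" using qpos by simp
  have "0 \<le> b" using opt[OF 0] by (simp add: b_def sum_negf)
  then have cq: "0 < s * cq" using less by simp
  \<comment> \<open>The variational inequality at the unit vector of index \<open>i\<close>, a point
    of \<open>K\<close> that represents row \<open>i\<close>.\<close>
  have row: "inner_n n (A i) q \<le> b" if i: "i < m" for i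
  proof -
    let ?e = "\<lambda>k. if k = i then 1 else 0 :: real"
    have "?e \<in> K" using i by (auto simp: K_def)
    from opt[OF this] have "(\<Sum>j<n. q j * (\<Sum>k<m. ?e k * A k j)) \<le> b"
      by (simp only: b_def left_diff_distrib sum_subtractf right_diff_distrib diff_le_0_iff_le)
    also have "(\<Sum>k<m. ?e k * A k j) = (\<Sum>k<m. if k = i then A k j else 0)" for j
      by (intro sum.cong) auto
    then have "(\<Sum>j<n. q j * (\<Sum>k<m. ?e k * A k j)) = inner_n n (A i) q"
      using i by (simp add: inner_n_def mult.commute)
    finally show ?thesis .
  qed
  show thesis
  proof (rule that)
    have sc: "inner_n n a (\<lambda>j. q j / (s * cq)) = inner_n n a q / (s * cq)" for a
      by (simp add: inner_n_def sum_divide_distrib)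
    show "(\<lambda>j. q j / (s * cq)) \<in> lp_feasible m n A"
      unfolding lp_feasible_def mem_Collect_eq sc
      using row less cq by (auto simp: divide_le_eq_1 intro: order_trans[OF _ less_imp_le[OF less]])
    show "inner_n n c (\<lambda>j. q j / (s * cq)) = 1 / s"
      unfolding sc cq_def[symmetric] using cq s by (auto simp: zero_less_mult_iff)
  qed
qed

text \<open>Round \<open>x\<close> to a nonzero grid point \<open>\<eta> z\<close>. More than
  \<open>K\<close> rows reach \<open>s * (1 - \<theta>)\<close> on it; if all of them failed on
  \<open>x\<close>, the remainder \<open>u\<close> would take off more than
  \<open>4 * \<theta> * sqrt (m / K)\<close> in each, so that the squared norm of \<open>A u\<close>
  would exceed \<open>16 * \<theta>\<^sup>2 * m\<close>. The cube bound from the sign vectors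
  forbids this.\<close>

lemma row_exceedance_on_sphere:
  fixes K s \<theta> :: real and A :: "nat \<Rightarrow> nat \<Rightarrow> real"
  assumes n: "0 < n" and \<theta>: "0 < \<theta>" "\<theta> < 1" and K: "0 < K" and s: "0 \<le> s" and b: "2 * real n / \<theta> \<le> real b"
    and grid: "\<And>z. z \<in> PiE {..<n} (\<lambda>_. {- int b..int b}) \<Longrightarrow> (\<Sum>j<n. real_of_int \<bar>z j\<bar>) \<le> 2 * real n / \<theta> \<Longrightarrow>
      \<exists>j<n. z j \<noteq> 0 \<Longrightarrow>
      K < card {i \<in> {..<m}. s * L2_set (\<lambda>j. real_of_int (z j)) {..<n} \<le> (\<Sum>j<n. A i j * real_of_int (z j))}"
    and signs: "\<And>\<sigma>. \<sigma> \<in> PiE {..<n} (\<lambda>_. {-1, 1}) \<Longrightarrow> L2_set (\<lambda>i. \<Sum>j<n. A i j * \<sigma> j) {..<m} \<le> 4 * sqrt (real m * real n)"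
    and x: "L2_set x {..<n} = 1"
  shows "\<exists>i<m. s * (1 - \<theta>) - 4 * \<theta> * sqrt (m / K) \<le> inner_n n (A i) x"
proof (rule ccontr)
  assume "\<not> ?thesis"
  then have neg: "\<And>i. i < m \<Longrightarrow> inner_n n (A i) x < s * (1 - \<theta>) - 4 * \<theta> * sqrt (m / K)" by force
  \<comment> \<open>A cube of side \<open>\<theta> / sqrt n\<close> has diameter
    \<open>\<theta>\<close>, so rounding moves \<open>x\<close> by at most
    \<open>\<theta>\<close>.\<close>
  define \<eta> where "\<eta> = \<theta> / sqrt n"
  have \<eta>: "0 < \<eta>" "sqrt n * \<eta> = \<theta>" using n \<theta> by (auto simp: \<eta>_def)
  define z where "z = (\<lambda>j\<in>{..<n}. \<lfloor>x j / \<eta>\<rfloor>)"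
  define u where "u j = x j - \<eta> * real_of_int (z j)" for j
  define r where "r = L2_set (\<lambda>j. real_of_int (z j)) {..<n}"
  have u: "0 \<le> u j" "u j \<le> \<eta>" if "j < n" for j
  proof -
    have "real_of_int (z j) \<le> x j / \<eta>" "x j / \<eta> \<le> real_of_int (z j) + 1"
      using that by (auto simp: z_def intro: less_imp_le)
    then show "0 \<le> u j" "u j \<le> \<eta>" using \<eta>(1) by (auto simp: u_def field_simps)
  qed
  have Lu: "L2_set u {..<n} \<le> \<theta>"
  proof -
    have "L2_set u {..<n} \<le> L2_set (\<lambda>_. \<eta>) {..<n}" using u by (intro L2_set_mono) auto
    also have "\<dots> = \<theta>" using \<eta> by (simp add: L2_set_constant)
    finally show ?thesis .
  qed
  have \<eta>r: "L2_set (\<lambda>j. \<eta> * real_of_int (z j)) {..<n} = \<eta> * r" "L2_set (\<lambda>j. - u j) {..<n} = L2_set u {..<n}"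
    using \<eta>(1) by (simp add: L2_set_cmult r_def) (simp add: L2_set_def)
  have "L2_set x {..<n} \<le> \<eta> * r + L2_set u {..<n}"
    using L2_set_triangle_ineq[of "\<lambda>j. \<eta> * real_of_int (z j)" u "{..<n}"] \<eta>r by (simp add: u_def)
  then have r1: "1 - \<theta> \<le> \<eta> * r" using x Lu by simp
  have "\<eta> * r \<le> L2_set x {..<n} + L2_set u {..<n}"
    using L2_set_triangle_ineq[of x "\<lambda>j. - u j" "{..<n}"] \<eta>r by (simp add: u_def)
  then have r2: "\<eta> * r \<le> 2" using x Lu \<theta> by simp
  have "(\<Sum>j<n. real_of_int \<bar>z j\<bar>) \<le> L2_set (\<lambda>j. real_of_int \<bar>z j\<bar>) {..<n} * L2_set (\<lambda>_. 1) {..<n}"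
    using inner_le_L2_set[of "\<lambda>j. real_of_int \<bar>z j\<bar>" "\<lambda>_. 1"] by simp
  also have "\<dots> = r * sqrt n" by (simp add: L2_set_def r_def)
  also have "\<dots> = \<eta> * r * (n / \<theta>)"
    unfolding \<eta>_def using n \<theta> by (simp add: field_simps)
  also have "\<dots> \<le> 2 * (n / \<theta>)" using r2 \<theta> by (intro mult_right_mono) auto
  finally have z1: "(\<Sum>j<n. real_of_int \<bar>z j\<bar>) \<le> 2 * real n / \<theta>" by simp
  have zb: "z \<in> PiE {..<n} (\<lambda>_. {- int b..int b})"
  proof (rule PiE_I)
    fix j assume j: "j \<in> {..<n}"
    have "real_of_int \<bar>z j\<bar> \<le> (\<Sum>j<n. real_of_int \<bar>z j\<bar>)"
      using j by (intro member_le_sum[of j "{..<n}" "\<lambda>j. real_of_int \<bar>z j\<bar>"]) auto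
    also note z1 also note b
    finally have "\<bar>z j\<bar> \<le> int b" by linarith
    then show "z j \<in> {- int b..int b}" by auto
  qed (simp add: z_def)
  have znz: "\<exists>j<n. z j \<noteq> 0"
  proof (rule ccontr)
    assume "\<not> (\<exists>j<n. z j \<noteq> 0)"
    then have "r = 0" by (simp add: r_def L2_set_def)
    then show False using r1 \<theta> by simp
  qed
  define I where "I = {i \<in> {..<m}. s * r \<le> (\<Sum>j<n. A i j * real_of_int (z j))}"
  have I: "K < card I" "finite I" "I \<subseteq> {..<m}" using grid[OF zb z1 znz] by (auto simp: I_def r_def)
  have m: "0 < m"
    using I K by (cases "m = 0") (auto simp: I_def)
  define v where "v i = (\<Sum>j<n. A i j * u j)" for i
  have vI: "16 * \<theta>\<^sup>2 * (m / K) \<le> (v i)\<^sup>2" if i: "i \<in> I" for i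
  proof -
    have "inner_n n (A i) x = \<eta> * (\<Sum>j<n. A i j * real_of_int (z j)) + v i"
      by (simp add: inner_n_def v_def u_def sum_distrib_left algebra_simps flip: sum.distrib)
    moreover have "\<eta> * (s * r) \<le> \<eta> * (\<Sum>j<n. A i j * real_of_int (z j))"
      using i \<eta>(1) by (intro mult_left_mono) (auto simp: I_def)
    moreover have "s * (1 - \<theta>) \<le> s * (\<eta> * r)" using s r1 by (rule mult_left_mono[rotated])
    moreover have "inner_n n (A i) x < s * (1 - \<theta>) - 4 * \<theta> * sqrt (m / K)"
      using neg i I by auto
    ultimately have "4 * \<theta> * sqrt (m / K) \<le> - v i" by (simp add: algebra_simps)
    then have "(4 * \<theta> * sqrt (m / K))\<^sup>2 \<le> (- v i)\<^sup>2"
      using \<theta> K by (intro power_mono) auto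
    then show ?thesis using K by (simp add: power_mult_distrib)
  qed
  have "16 * \<theta>\<^sup>2 * m = K * (16 * \<theta>\<^sup>2 * (m / K))" using K by simp
  also have "\<dots> < card I * (16 * \<theta>\<^sup>2 * (m / K))"
    using I(1) K m \<theta> by (intro mult_strict_right_mono) auto
  also have "\<dots> \<le> (\<Sum>i\<in>I. (v i)\<^sup>2)"
    using sum_mono[of I "\<lambda>_. 16 * \<theta>\<^sup>2 * (m / K)"] vI by simp
  also have "\<dots> \<le> (\<Sum>i<m. (v i)\<^sup>2)" using I by (intro sum_mono2) auto
  also have "\<dots> = (L2_set v {..<m})\<^sup>2" by (simp add: L2_set_power2)
  also have "L2_set v {..<m} \<le> \<eta> * (4 * sqrt (real m * real n))"
    unfolding v_def using u \<eta>(1) by (intro L2_set_image_cube signs) auto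
  then have "(L2_set v {..<m})\<^sup>2 \<le> (\<eta> * (4 * sqrt (real m * real n)))\<^sup>2"
    by (intro power_mono) auto
  also have "\<dots> = 16 * \<theta>\<^sup>2 * m"
    using n by (simp add: \<eta>_def power_mult_distrib power_divide)
  finally show False by simp
qed

text \<open>The bracket bounds \<open>|y|_2\<close>. Its first term comes from \<open>low\<close>:
  the transpose maps \<open>z / k\<close> to \<open>s' c\<close> minus the image of
  \<open>u\<close>, a vector of norm at most \<open>s' + 4 * sqrt (n / k)\<close>. Its second term
  bounds the norm of the remainder \<open>u\<close>.\<close>

lemma hull_multiple_bound:
  fixes A :: "nat \<Rightarrow> nat \<Rightarrow> real" and E s s' :: real
  assumes n: "0 < n" and k: "0 < k" and c: "L2_set c {..<n} = 1" and s: "0 \<le> s" "0 \<le> s'"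
    and low: "\<And>z. z \<in> PiE {..<m} (\<lambda>_. {- int k..int k}) \<Longrightarrow> (\<Sum>i<m. real_of_int \<bar>z i\<bar>) \<le> real k \<Longrightarrow>
       \<exists>i<m. z i \<noteq> 0 \<Longrightarrow>
       sqrt n / 16 * L2_set (\<lambda>i. real_of_int (z i)) {..<m} \<le> L2_set (\<lambda>j. \<Sum>i<m. real_of_int (z i) * A i j) {..<n}"
    and up: "\<And>z. z \<in> PiE {..<m} (\<lambda>_. {- int k..int k}) \<Longrightarrow> (\<Sum>i<m. real_of_int \<bar>z i\<bar>) \<le> real k \<Longrightarrow>
       \<exists>i<m. z i \<noteq> 0 \<Longrightarrow>
       L2_set (\<lambda>j. \<Sum>i<m. real_of_int (z i) * A i j) {..<n} \<le> 4 * sqrt n * L2_set (\<lambda>i. real_of_int (z i)) {..<m}"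
    and E: "(\<Sum>i<m. (max 0 (inner_n n (A i) c - s))\<^sup>2) \<le> E"
    and y: "\<forall>i<m. 0 \<le> y i" "(\<Sum>i<m. y i) \<le> 1"
    and eq: "\<forall>j<n. (\<Sum>i<m. y i * A i j) = s' * c j"
  shows "s' \<le> s + sqrt E * (16 * (s' + 4 * sqrt (n / k)) / sqrt n + 1 / sqrt k)"
proof -
  \<comment> \<open>Rounding down keeps \<open>z \<ge> 0\<close> and its sum at most
    \<open>k\<close>, and leaves a remainder in the capped simplex.\<close>
  define z where "z = (\<lambda>i\<in>{..<m}. \<lfloor>k * y i\<rfloor>)"
  define u where "u i = y i - real_of_int (z i) / k" for i
  have z: "0 \<le> z i" "real_of_int (z i) \<le> k * y i" "k * y i \<le> real_of_int (z i) + 1" if "i < m" for i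
    using that y(1) by (auto simp: z_def intro: less_imp_le)
  have u: "0 \<le> u i" "u i \<le> 1 / k" if "i < m" for i
  proof -
    have "real_of_int (z i) / k \<le> y i" "y i \<le> (real_of_int (z i) + 1) / k"
      using z[OF that] k by (auto simp: divide_le_eq le_divide_eq mult.commute)
    then show "0 \<le> u i" "u i \<le> 1 / k" by (auto simp: u_def add_divide_distrib)
  qed
  have "(\<Sum>i<m. u i) \<le> (\<Sum>i<m. y i)"
    using z(1) k by (intro sum_mono) (auto simp: u_def)
  then have u1: "(\<Sum>i<m. u i) \<le> 1" using y by simp
  have "(\<Sum>i<m. real_of_int \<bar>z i\<bar>) \<le> (\<Sum>i<m. k * y i)" using z by (intro sum_mono) auto
  also have "\<dots> = k * (\<Sum>i<m. y i)" by (simp add: sum_distrib_left)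
  also have "\<dots> \<le> real k * 1" using y by (intro mult_left_mono) auto
  finally have z1: "(\<Sum>i<m. real_of_int \<bar>z i\<bar>) \<le> real k" by simp
  have zk: "z \<in> PiE {..<m} (\<lambda>_. {- int k..int k})"
  proof (rule PiE_I)
    fix i assume i: "i \<in> {..<m}"
    have "real_of_int \<bar>z i\<bar> \<le> (\<Sum>i<m. real_of_int \<bar>z i\<bar>)"
      using i by (intro member_le_sum[of i "{..<m}" "\<lambda>i. real_of_int \<bar>z i\<bar>"]) auto
    also note z1
    finally have "\<bar>z i\<bar> \<le> int k" by linarith
    then show "z i \<in> {- int k..int k}" by auto
  qed (simp add: z_def)
  have subset: "L2_set (\<lambda>j. \<Sum>i\<in>S. A i j) {..<n} \<le> 4 * sqrt n * sqrt k" if S: "S \<subseteq> {..<m}" "card S \<le> k" for S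
  proof (cases "S = {}")
    case False
    have fS: "finite S" using S finite_subset by blast
    define w where "w = (\<lambda>i\<in>{..<m}. if i \<in> S then 1 else 0 :: int)"
    have wS: "(\<Sum>i<m. f (w i) i) = (\<Sum>i\<in>S. f 1 i)" if "\<And>i. f 0 i = 0" for f :: "int \<Rightarrow> nat \<Rightarrow> real"
    proof -
      have "(\<Sum>i\<in>S. f 1 i) = (\<Sum>i\<in>S. f (w i) i)" using S by (intro sum.cong) (auto simp: w_def)
      also have "\<dots> = (\<Sum>i<m. f (w i) i)"
        using S that by (intro sum.mono_neutral_left) (auto simp: w_def)
      finally show ?thesis by simp
    qed
    have "L2_set (\<lambda>j. \<Sum>i<m. real_of_int (w i) * A i j) {..<n} \<le> 4 * sqrt n * L2_set (\<lambda>i. real_of_int (w i)) {..<m}"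
    proof (rule up)
      show "w \<in> PiE {..<m} (\<lambda>_. {- int k..int k})" using k by (auto simp: w_def)
      show "(\<Sum>i<m. real_of_int \<bar>w i\<bar>) \<le> real k" using wS[of "\<lambda>a _. real_of_int \<bar>a\<bar>"] S by simp
      obtain i where "i \<in> S" using False by auto
      then show "\<exists>i<m. w i \<noteq> 0" using S by (intro exI[of _ i]) (auto simp: w_def)
    qed
    moreover have "L2_set (\<lambda>i. real_of_int (w i)) {..<m} = sqrt (card S)"
      using wS[of "\<lambda>a _. (real_of_int a)\<^sup>2"] by (simp add: L2_set_def)
    moreover have "(\<Sum>i<m. real_of_int (w i) * A i j) = (\<Sum>i\<in>S. A i j)" for j
      using wS[of "\<lambda>a i. real_of_int a * A i j"] by simp
    moreover have "4 * sqrt n * sqrt (card S) \<le> 4 * sqrt n * sqrt k" using S by (intro mult_left_mono) auto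
    ultimately show ?thesis by simp
  qed (simp add: L2_set_0')
  have "L2_set (\<lambda>j. \<Sum>i<m. u i * A i j) {..<n} \<le> 4 * sqrt n * sqrt k / k"
    using u u1 k subset by (intro L2_set_image_capped_simplex) auto
  also have "\<dots> = 4 * sqrt (n / k)" using k by (simp add: real_sqrt_divide field_simps)
  finally have Au: "L2_set (\<lambda>j. \<Sum>i<m. u i * A i j) {..<n} \<le> 4 * sqrt (n / k)" .
  have "L2_set (\<lambda>j. \<Sum>i<m. y i * A i j) {..<n} = L2_set (\<lambda>j. s' * c j) {..<n}"
    using eq by (intro L2_set_cong) auto
  also have "\<dots> = s'" using c s by (simp add: L2_set_cmult)
  finally have Ay: "L2_set (\<lambda>j. \<Sum>i<m. y i * A i j) {..<n} = s'" .
  have "L2_set (\<lambda>j. \<Sum>i<m. real_of_int (z i) * A i j) {..<n}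
     = L2_set (\<lambda>j. k * ((\<Sum>i<m. y i * A i j) + - (\<Sum>i<m. u i * A i j))) {..<n}"
    using k by (intro L2_set_cong) (auto simp: u_def sum_distrib_left algebra_simps simp flip: sum_subtractf)
  also have "\<dots> \<le> k * (s' + 4 * sqrt (n / k))"
    unfolding L2_set_cmult
    using L2_set_triangle_ineq[of "\<lambda>j. \<Sum>i<m. y i * A i j" "\<lambda>j. - (\<Sum>i<m. u i * A i j)" "{..<n}"] Ay Au
      L2_set_cmult[of "-1" "\<lambda>j. \<Sum>i<m. u i * A i j"]
    by (auto intro!: mult_left_mono)
  finally have Az: "L2_set (\<lambda>j. \<Sum>i<m. real_of_int (z i) * A i j) {..<n} \<le> k * (s' + 4 * sqrt (n / k))" .
  have "sqrt n / 16 * L2_set (\<lambda>i. real_of_int (z i)) {..<m} \<le> k * (s' + 4 * sqrt (n / k))"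
  proof (cases "\<exists>i<m. z i \<noteq> 0")
    case True
    then show ?thesis using low[OF zk z1] Az by simp
  next
    case False
    then show ?thesis using s by (simp add: L2_set_def)
  qed
  then have Lz: "L2_set (\<lambda>i. real_of_int (z i)) {..<m} / k \<le> 16 * (s' + 4 * sqrt (n / k)) / sqrt n"
    using n k by (simp add: field_simps)
  \<comment> \<open>Each \<open>u i\<close> is at most \<open>1 / k\<close> and they sum to at most
    1.\<close>
  have "(\<Sum>i<m. (u i)\<^sup>2) \<le> (\<Sum>i<m. u i * (1 / k))"
    unfolding power2_eq_square using u by (intro sum_mono mult_left_mono) auto
  also have "\<dots> \<le> 1 / k" using u1 k by (simp add: divide_right_mono flip: sum_divide_distrib)
  finally have "L2_set u {..<m} \<le> sqrt (1 / k)" unfolding L2_set_def by simp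
  then have Lu: "L2_set u {..<m} \<le> 1 / sqrt k" by (simp add: real_sqrt_divide)
  have "L2_set y {..<m} = L2_set (\<lambda>i. 1 / k * real_of_int (z i) + u i) {..<m}"
    by (intro L2_set_cong) (auto simp: u_def)
  also have "\<dots> \<le> L2_set (\<lambda>i. real_of_int (z i)) {..<m} / k + L2_set u {..<m}"
    using L2_set_triangle_ineq[of "\<lambda>i. 1 / k * real_of_int (z i)" u "{..<m}"] by (simp only: L2_set_cmult) simp
  finally have Ly: "L2_set y {..<m} \<le> 16 * (s' + 4 * sqrt (n / k)) / sqrt n + 1 / sqrt k" using Lz Lu by simp
  \<comment> \<open>Pairing \<open>eq\<close> with the unit vector \<open>c\<close> gives
    \<open>s'\<close> as a combination of the \<open>inner_n n (A i) c\<close>. The part of each up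
    to \<open>s\<close> contributes at most \<open>s\<close> in total, and the excess is treated by
    Cauchy-Schwarz.\<close>
  have "s' = s' * (\<Sum>j<n. (c j)\<^sup>2)" using c by (simp flip: L2_set_power2)
  also have "\<dots> = (\<Sum>j<n. (\<Sum>i<m. y i * A i j) * c j)"
    using eq by (simp add: sum_distrib_left power2_eq_square mult_ac)
  also have "\<dots> = (\<Sum>i<m. y i * inner_n n (A i) c)"
    unfolding sum_distrib_right inner_n_def sum_distrib_left by (subst sum.swap) (simp add: mult_ac)
  also have "\<dots> \<le> (\<Sum>i<m. y i * (max 0 (inner_n n (A i) c - s) + s))"
    using y by (intro sum_mono mult_left_mono) auto
  also have "\<dots> = (\<Sum>i<m. y i * max 0 (inner_n n (A i) c - s)) + (\<Sum>i<m. y i) * s"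
    by (simp add: distrib_left sum.distrib sum_distrib_right)
  also have "\<dots> \<le> L2_set y {..<m} * L2_set (\<lambda>i. max 0 (inner_n n (A i) c - s)) {..<m} + 1 * s"
    using y s by (intro add_mono inner_le_L2_set mult_right_mono) auto
  also have "\<dots> \<le> (16 * (s' + 4 * sqrt (n / k)) / sqrt n + 1 / sqrt k) * sqrt E + 1 * s"
    using Ly E s by (intro add_mono mult_mono order_refl) (auto simp: L2_set_def intro!: sum_nonneg)
  finally show ?thesis by (simp add: mult.commute)
qed

section \<open>Measurability of the optimal value\<close>

lemma rational_sequence: "\<exists>q. (\<forall>k. q k \<in> \<rat>) \<and> q \<longlonglongrightarrow> (y::real)"
proof -
  have "\<exists>q\<in>\<rat>. y < q \<and> q < y + 1 / real (Suc k)" for k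
    by (rule Rats_dense_in_real) simp
  then obtain q where q: "\<And>k. q k \<in> \<rat>" "\<And>k. y < q k" "\<And>k. q k < y + 1 / real (Suc k)" by metis
  have "(\<lambda>k. y + 1 / real (Suc k)) \<longlonglongrightarrow> y + 0"
    using LIMSEQ_inverse_real_of_nat by (intro tendsto_intros) (simp add: inverse_eq_divide)
  then have "q \<longlonglongrightarrow> y"
    using q by (intro tendsto_sandwich[OF _ _ tendsto_const[of y], of q _ "\<lambda>k. y + 1 / real (Suc k)"])
      (auto intro!: always_eventually less_imp_le)
  then show ?thesis using q by blast
qed

text \<open>A feasible point shrunk by a factor \<open>1 - d\<close> satisfies all constraints
  strictly, so its rational approximations are feasible with nearly the same objective. The supremum
  thus runs over a countable set; the default 0 at infeasible points is harmless because the value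
  is nonnegative.\<close>

lemma lp_value_eq_rational_SUP:
  "lp_value m n A c = (SUP q\<in>PiE {..<n} (\<lambda>_. \<rat>). if q \<in> lp_feasible m n A then ereal (inner_n n c q) else 0)"
    (is "_ = ?R")
proof (rule antisym)
  show "?R \<le> lp_value m n A c"
    by (rule SUP_least) (auto intro: lp_value_ge lp_value_nonneg)
  show "lp_value m n A c \<le> ?R"
    unfolding lp_value_def
  proof (rule SUP_least)
    fix x assume x: "x \<in> lp_feasible m n A"
    have dense: "ereal r \<le> ?R" if "r < inner_n n c x" for r
    proof -
      note that
      moreover have "((\<lambda>d. inner_n n c (\<lambda>j. (1 - d) * x j)) \<longlongrightarrow> inner_n n c (\<lambda>j. (1 - 0) * x j)) (at_right 0)"
        unfolding inner_n_def by (intro tendsto_intros)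
      ultimately have "eventually (\<lambda>d. r < inner_n n c (\<lambda>j. (1 - d) * x j)) (at_right 0)"
        by (auto dest: order_tendstoD(1))
      moreover have "eventually (\<lambda>d. 0 < d \<and> d < 1) (at_right (0::real))"
        by (simp add: eventually_at_right_field) (meson zero_less_one)
      ultimately have "eventually (\<lambda>d. r < inner_n n c (\<lambda>j. (1 - d) * x j) \<and> 0 < d \<and> d < 1) (at_right 0)"
        by eventually_elim auto
      then obtain d where d: "r < inner_n n c (\<lambda>j. (1 - d) * x j)" "0 < d" "d < 1"
        using eventually_happens trivial_limit_at_right_real by blast
      have "\<forall>j. \<exists>q. (\<forall>k. q k \<in> \<rat>) \<and> q \<longlonglongrightarrow> (1 - d) * x j" using rational_sequence by blast
      then obtain q where q: "\<And>j k. q j k \<in> \<rat>" "\<And>j. q j \<longlonglongrightarrow> (1 - d) * x j" by metis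
      define Q where "Q k = (\<lambda>j\<in>{..<n}. q j k)" for k
      have lim: "(\<lambda>k. inner_n n a (Q k)) \<longlonglongrightarrow> inner_n n a (\<lambda>j. (1 - d) * x j)" for a
        unfolding inner_n_def Q_def using q(2) by (auto intro!: tendsto_intros)
      have strict: "inner_n n (A i) (\<lambda>j. (1 - d) * x j) < 1" if "i < m" for i
      proof -
        have "inner_n n (A i) (\<lambda>j. (1 - d) * x j) = (1 - d) * inner_n n (A i) x"
          by (simp add: inner_n_def sum_distrib_left mult_ac)
        also have "\<dots> \<le> (1 - d) * 1" using x that d by (intro mult_left_mono) (auto simp: lp_feasible_def)
        finally show ?thesis using d by simp
      qed
      have "eventually (\<lambda>k. r < inner_n n c (Q k)) sequentially"
        using order_tendstoD(1)[OF lim d(1)] .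
      moreover have "eventually (\<lambda>k. \<forall>i\<in>{..<m}. inner_n n (A i) (Q k) < 1) sequentially"
        using order_tendstoD(2)[OF lim strict] by (intro eventually_ball_finite) auto
      ultimately have "eventually (\<lambda>k. r < inner_n n c (Q k) \<and> (\<forall>i\<in>{..<m}. inner_n n (A i) (Q k) < 1)) sequentially"
        by eventually_elim auto
      then obtain k where k: "r < inner_n n c (Q k)" "\<forall>i\<in>{..<m}. inner_n n (A i) (Q k) < 1"
        using eventually_happens trivial_limit_sequentially by blast
      have "ereal r \<le> (if Q k \<in> lp_feasible m n A then ereal (inner_n n c (Q k)) else 0)"
        using k by (auto simp: lp_feasible_def less_imp_le)
      also have "\<dots> \<le> ?R" using q by (intro SUP_upper) (auto simp: Q_def split: if_splits)
      finally show "ereal r \<le> ?R" .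
    qed
    show "ereal (inner_n n c x) \<le> ?R"
    proof (rule ccontr)
      assume "\<not> ?thesis"
      then obtain r where "?R < ereal r" "ereal r < ereal (inner_n n c x)"
        using ereal_dense2[of ?R "ereal (inner_n n c x)"] by (auto simp: not_le)
      then show False using dense[of r] by simp
    qed
  qed
qed

lemma borel_measurable_lp_value:
  assumes [measurable]: "\<And>i j. i < m \<Longrightarrow> j < n \<Longrightarrow> A i j \<in> borel_measurable M"
  shows "(\<lambda>\<omega>. lp_value m n (\<lambda>i j. A i j \<omega>) c) \<in> borel_measurable M"
  unfolding lp_value_eq_rational_SUP
proof (rule borel_measurable_SUP)
  show "countable (PiE {..<n} (\<lambda>_. \<rat>))" by (intro countable_PiE countable_rat) auto
  fix q :: "nat \<Rightarrow> real"
  have "Measurable.pred M (\<lambda>\<omega>. \<forall>i\<in>{..<m}. (\<Sum>j<n. A i j \<omega> * q j) \<le> 1)"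
    by measurable
  then have [measurable]: "Measurable.pred M (\<lambda>\<omega>. q \<in> lp_feasible m n (\<lambda>i j. A i j \<omega>))"
    by (simp add: lp_feasible_def inner_n_def)
  show "(\<lambda>\<omega>. if q \<in> lp_feasible m n (\<lambda>i j. A i j \<omega>) then ereal (inner_n n c q) else 0) \<in> borel_measurable M"
    by measurable
qed

section \<open>Tail bounds for a fixed dimension\<close>

lemma sum_normalized_squares:
  assumes "0 < L2_set w I"
  shows "(\<Sum>i\<in>I. (w i / L2_set w I)\<^sup>2) = 1"
proof -
  have "(\<Sum>i\<in>I. (w i / L2_set w I)\<^sup>2) = (L2_set w I)\<^sup>2 / (L2_set w I)\<^sup>2"
    by (simp add: power_divide L2_set_power2 flip: sum_divide_distrib)
  then show ?thesis using assms by simp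
qed

context prob_space
begin

lemma prob_UN_le:
  fixes p :: real
  assumes "finite Z" "\<And>z. z \<in> Z \<Longrightarrow> B z \<in> events" "\<And>z. z \<in> Z \<Longrightarrow> prob (B z) \<le> p"
  shows "prob (\<Union>z\<in>Z. B z) \<le> card Z * p"
proof -
  have "prob (\<Union>z\<in>Z. B z) \<le> (\<Sum>z\<in>Z. prob (B z))"
    using assms by (intro finite_measure_subadditive_finite) auto
  also have "\<dots> \<le> (\<Sum>z\<in>Z. p)" by (intro sum_mono assms)
  finally show ?thesis by simp
qed

lemma gaussian_matrix_measurable:
  assumes A: "standard_gaussian_matrix M m n A" and "i < m" "j < n"
  shows "random_variable borel (A i j)"
  using gaussian_family_measurable[OF A[unfolded standard_gaussian_matrix_family], of "(i, j)"] assms by auto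

text \<open>Union bound over the hypotheses of \<open>row_exceedance_on_sphere\<close>: the first
  term is for lattice points exceeded by at most \<open>K\<close> rows, the second for the
  \<open>2 ^ n\<close> sign vectors with too large an image.\<close>

lemma lp_value_upper_tail:
  fixes A :: "nat \<Rightarrow> nat \<Rightarrow> 'a \<Rightarrow> real" and c :: "nat \<Rightarrow> real"
  assumes A: "standard_gaussian_matrix M m n A" and c: "L2_set c {..<n} = 1" and n: "0 < n"
    and \<theta>: "0 < \<theta>" "\<theta> < 1" and K: "0 < K" and s: "0 < s" "0 \<le> s1"
    and le: "s \<le> s1 * (1 - \<theta>) - 4 * \<theta> * sqrt (m / K)"
  shows "prob {\<omega> \<in> space M. ereal (1 / s) < lp_value m n (\<lambda>i j. A i j \<omega>) c}
     \<le> (exp 1 * (1 + 4 / \<theta>)) ^ n * exp (K - m * (exp (- (s1 + 1)\<^sup>2 / 2) / 6)) + 2 ^ n * exp (- 3 * real m)"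
proof -
  have [measurable]: "\<And>i j. i < m \<Longrightarrow> j < n \<Longrightarrow> random_variable borel (A i j)"
    using gaussian_matrix_measurable[OF A] .
  obtain b :: nat where b: "2 * real n / \<theta> \<le> real b" using real_arch_simple by blast
  define Z where "Z = {z \<in> PiE {..<n} (\<lambda>_. {- int b..int b}). (\<Sum>j<n. real_of_int \<bar>z j\<bar>) \<le> 2 * real n / \<theta>}"
  define Z' where "Z' = {z \<in> Z. \<exists>j<n. z j \<noteq> 0}"
  define norm where "norm z = L2_set (\<lambda>j. real_of_int (z j)) {..<n}" for z
  define B1 where "B1 z = {\<omega> \<in> space M. card {i \<in> {..<m}. s1 * norm z \<le> (\<Sum>j<n. A i j \<omega> * real_of_int (z j))} \<le> K}" for z
  define S where "S = PiE {..<n} (\<lambda>_. {-1, 1 :: real})"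
  define B2 where "B2 \<sigma> = {\<omega> \<in> space M. 16 * (real m * real n) \<le> (\<Sum>i<m. (\<Sum>j<n. A i j \<omega> * \<sigma> j)\<^sup>2)}" for \<sigma>
  have fin: "finite Z" "finite Z'" "finite S"
    unfolding Z_def Z'_def S_def by (auto intro!: finite_PiE finite_Collect_conjI)
  have pB1: "prob (B1 z) \<le> exp (K - m * (exp (- (s1 + 1)\<^sup>2 / 2) / 6))" "B1 z \<in> events" if z: "z \<in> Z'" for z
  proof -
    have N: "0 < norm z"
    proof -
      obtain j where "j < n" "z j \<noteq> 0" using z by (auto simp: Z'_def)
      then have "norm z \<noteq> 0" unfolding norm_def by (subst L2_set_eq_0_iff) auto
      then show ?thesis using L2_set_nonneg[of "\<lambda>j. real_of_int (z j)" "{..<n}"] unfolding norm_def by linarith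
    qed
    define w where "w j = real_of_int (z j) / norm z" for j
    have "gaussian_family M (\<lambda>i \<omega>. \<Sum>j<n. A i j \<omega> * w j) {..<m}"
      using gaussian_matrix_rows[OF A, of w] sum_normalized_squares[of "\<lambda>j. real_of_int (z j)" "{..<n}"] N
      by (simp add: w_def norm_def)
    from gaussian_exceedance_count[OF this _ s(2), of K]
    have p: "prob {\<omega> \<in> space M. card {i \<in> {..<m}. s1 \<le> (\<Sum>j<n. A i j \<omega> * w j)} \<le> K}
      \<le> exp (K - m * (exp (- (s1 + 1)\<^sup>2 / 2) / 6))" by simp
    have eq: "s1 \<le> (\<Sum>j<n. A i j \<omega> * w j) \<longleftrightarrow> s1 * norm z \<le> (\<Sum>j<n. A i j \<omega> * real_of_int (z j))" for i \<omega>
      using N by (simp add: w_def pos_le_divide_eq flip: sum_divide_distrib)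
    show "prob (B1 z) \<le> exp (K - m * (exp (- (s1 + 1)\<^sup>2 / 2) / 6))"
      using p unfolding eq B1_def .
    show "B1 z \<in> events" unfolding B1_def by measurable
  qed
  have pB2: "prob (B2 \<sigma>) \<le> exp (- 3 * real m)" "B2 \<sigma> \<in> events" if \<sigma>: "\<sigma> \<in> S" for \<sigma>
  proof -
    have "(\<Sum>j<n. (\<sigma> j / sqrt n)\<^sup>2) = (\<Sum>j<n. 1 / n)"
    proof (intro sum.cong refl)
      fix j assume "j \<in> {..<n}"
      then have "\<sigma> j \<in> {-1, 1}" using \<sigma> by (auto simp: S_def PiE_iff)
      then show "(\<sigma> j / sqrt n)\<^sup>2 = 1 / n" by (auto simp: power_divide)
    qed
    then have "gaussian_family M (\<lambda>i \<omega>. \<Sum>j<n. A i j \<omega> * (\<sigma> j / sqrt n)) {..<m}"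
      using n by (intro gaussian_matrix_rows[OF A]) simp
    from gaussian_sum_squares_upper[OF this]
    have p: "prob {\<omega> \<in> space M. 16 * real m \<le> (\<Sum>i<m. (\<Sum>j<n. A i j \<omega> * (\<sigma> j / sqrt n))\<^sup>2)} \<le> exp (- 3 * real m)" by simp
    have "(\<Sum>i<m. (\<Sum>j<n. A i j \<omega> * (\<sigma> j / sqrt n))\<^sup>2) = (\<Sum>i<m. (\<Sum>j<n. A i j \<omega> * \<sigma> j)\<^sup>2) / n" for \<omega>
      by (simp add: power_divide flip: sum_divide_distrib)
    then have "16 * real m \<le> (\<Sum>i<m. (\<Sum>j<n. A i j \<omega> * (\<sigma> j / sqrt n))\<^sup>2) \<longleftrightarrow>
      16 * (real m * real n) \<le> (\<Sum>i<m. (\<Sum>j<n. A i j \<omega> * \<sigma> j)\<^sup>2)" for \<omega>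
      using n by (simp add: pos_le_divide_eq mult_ac)
    then show "prob (B2 \<sigma>) \<le> exp (- 3 * real m)" using p unfolding B2_def by simp
    show "B2 \<sigma> \<in> events" unfolding B2_def by measurable
  qed
  have cZ: "real (card Z') \<le> (exp 1 * (1 + 4 / \<theta>)) ^ n"
  proof -
    have "card Z' \<le> card Z" using fin by (intro card_mono) (auto simp: Z'_def)
    \<comment> \<open>The parameter \<open>t = \<theta> / 2\<close> turns \<open>exp (t * N)\<close>
      into \<open>exp n\<close>.\<close>
    also have "real (card Z) \<le> exp (\<theta> / 2 * (2 * real n / \<theta>)) * (1 + 2 / (exp (\<theta> / 2) - 1)) ^ card {..<n}"
      unfolding Z_def using \<theta> by (intro card_bounded_integer_vectors) auto
    also have "\<dots> \<le> exp 1 ^ n * (1 + 4 / \<theta>) ^ n"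
    proof (rule mult_mono)
      have "\<theta> / 2 \<le> exp (\<theta> / 2) - 1" using exp_ge_add_one_self[of "\<theta> / 2"] by linarith
      then have "2 / (exp (\<theta> / 2) - 1) \<le> 2 / (\<theta> / 2)" using \<theta> by (intro divide_left_mono) auto
      then show "(1 + 2 / (exp (\<theta> / 2) - 1)) ^ card {..<n} \<le> (1 + 4 / \<theta>) ^ n"
        using \<theta> by (simp add: power_mono)
    qed (use \<theta> in \<open>auto simp flip: exp_of_nat_mult\<close>)
    finally show ?thesis by (simp add: power_mult_distrib)
  qed
  have cS: "card S = 2 ^ n" by (simp add: S_def card_PiE numeral_2_eq_2)
  have "{\<omega> \<in> space M. ereal (1 / s) < lp_value m n (\<lambda>i j. A i j \<omega>) c} \<subseteq> (\<Union>z\<in>Z'. B1 z) \<union> (\<Union>\<sigma>\<in>S. B2 \<sigma>)"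
  proof (rule subsetI, rule ccontr)
    fix \<omega> assume \<omega>: "\<omega> \<in> {\<omega> \<in> space M. ereal (1 / s) < lp_value m n (\<lambda>i j. A i j \<omega>) c}"
      and "\<omega> \<notin> (\<Union>z\<in>Z'. B1 z) \<union> (\<Union>\<sigma>\<in>S. B2 \<sigma>)"
    then have n1: "\<And>z. z \<in> Z' \<Longrightarrow> K < card {i \<in> {..<m}. s1 * norm z \<le> (\<Sum>j<n. A i j \<omega> * real_of_int (z j))}"
      and n2: "\<And>\<sigma>. \<sigma> \<in> S \<Longrightarrow> (\<Sum>i<m. (\<Sum>j<n. A i j \<omega> * \<sigma> j)\<^sup>2) \<le> 16 * (real m * real n)"
      by (auto simp: B1_def B2_def not_le less_imp_le)
    have n2': "L2_set (\<lambda>i. \<Sum>j<n. A i j \<omega> * \<sigma> j) {..<m} \<le> 4 * sqrt (real m * real n)" if "\<sigma> \<in> S" for \<sigma>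
    proof -
      have "L2_set (\<lambda>i. \<Sum>j<n. A i j \<omega> * \<sigma> j) {..<m} \<le> sqrt (16 * (real m * real n))"
        unfolding L2_set_def using n2[OF that] by (rule real_sqrt_le_mono)
      then show ?thesis by (simp add: real_sqrt_mult)
    qed
    have "lp_value m n (\<lambda>i j. A i j \<omega>) c \<le> ereal (1 / s)"
    proof (rule lp_value_le[OF s(1) c])
      fix x :: "nat \<Rightarrow> real" assume x: "L2_set x {..<n} = 1"
      have "\<exists>i<m. s1 * (1 - \<theta>) - 4 * \<theta> * sqrt (m / K) \<le> inner_n n (\<lambda>j. A i j \<omega>) x"
        using n \<theta> K s(2) b
      proof (rule row_exceedance_on_sphere)
        show "K < card {i \<in> {..<m}. s1 * L2_set (\<lambda>j. real_of_int (z j)) {..<n} \<le> (\<Sum>j<n. A i j \<omega> * real_of_int (z j))}"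
          if "z \<in> PiE {..<n} (\<lambda>_. {- int b..int b})" "(\<Sum>j<n. real_of_int \<bar>z j\<bar>) \<le> 2 * real n / \<theta>" "\<exists>j<n. z j \<noteq> 0" for z
          using n1[of z] that by (simp add: Z'_def Z_def norm_def)
      qed (use n2' x in \<open>auto simp: S_def\<close>)
      then show "\<exists>i<m. s \<le> inner_n n (\<lambda>j. A i j \<omega>) x" using le by (meson order_trans)
    qed
    then show False using \<omega> by auto
  qed
  then have "prob {\<omega> \<in> space M. ereal (1 / s) < lp_value m n (\<lambda>i j. A i j \<omega>) c}
     \<le> prob ((\<Union>z\<in>Z'. B1 z) \<union> (\<Union>\<sigma>\<in>S. B2 \<sigma>))"
    using pB1 pB2 fin by (intro finite_measure_mono sets.Un sets.finite_UN) auto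
  also have "\<dots> \<le> prob (\<Union>z\<in>Z'. B1 z) + prob (\<Union>\<sigma>\<in>S. B2 \<sigma>)"
    using pB1 pB2 fin by (intro measure_Un_le sets.Un sets.finite_UN) auto
  also have "\<dots> \<le> card Z' * exp (K - m * (exp (- (s1 + 1)\<^sup>2 / 2) / 6)) + card S * exp (- 3 * real m)"
    using pB1 pB2 fin by (intro add_mono prob_UN_le) auto
  also have "\<dots> \<le> (exp 1 * (1 + 4 / \<theta>)) ^ n * exp (K - m * (exp (- (s1 + 1)\<^sup>2 / 2) / 6)) + 2 ^ n * exp (- 3 * real m)"
    unfolding cS using cZ by (intro add_mono mult_right_mono) auto
  finally show ?thesis by simp
qed

text \<open>Union bound over the hypotheses of \<open>hull_multiple_bound\<close>; outside the bad
  events \<open>less\<close> keeps \<open>s' c\<close> out of the hull, and separation gives a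
  feasible point of value \<open>1 / s'\<close>. The first factor counts the lattice points of sum
  at most \<open>k\<close>.\<close>

lemma lp_value_lower_tail_moderate:
  fixes A :: "nat \<Rightarrow> nat \<Rightarrow> 'a \<Rightarrow> real" and c :: "nat \<Rightarrow> real"
    and m n k :: nat and s s' E \<alpha> :: real
  assumes A: "standard_gaussian_matrix M m n A" and c: "L2_set c {..<n} = 1" and n: "0 < n" and k: "0 < k" "0 < m"
    and s: "0 \<le> s" "0 < s'" and \<alpha>: "1/4 \<le> \<alpha>" "\<alpha> < 1/2"
    and less: "s + sqrt E * (16 * (s' + 4 * sqrt (n / k)) / sqrt n + 1 / sqrt k) < s'"
  shows "prob {\<omega> \<in> space M. lp_value m n (\<lambda>i j. A i j \<omega>) c < ereal (1 / s')}
     \<le> exp (k * (2 + ln (1 + m / k))) * (exp (- 3 * real n) + exp (- 2 * real n))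
       + exp (m * (exp (- \<alpha> * s\<^sup>2) / sqrt (1 - 2 * \<alpha>)) - E / 4)"
proof -
  have [measurable]: "\<And>i j. i < m \<Longrightarrow> j < n \<Longrightarrow> random_variable borel (A i j)"
    using gaussian_matrix_measurable[OF A] .
  define Z where "Z = {z \<in> PiE {..<m} (\<lambda>_. {- int k..int k}). (\<Sum>i<m. real_of_int \<bar>z i\<bar>) \<le> real k}"
  define Z' where "Z' = {z \<in> Z. \<exists>i<m. z i \<noteq> 0}"
  define norm where "norm z = L2_set (\<lambda>i. real_of_int (z i)) {..<m}" for z
  \<comment> \<open>\<open>Q z \<omega>\<close> is the squared norm of the transpose applied to
    \<open>z\<close>. For a fixed nonzero \<open>z\<close> it should lie between
    \<open>n / 256\<close> and \<open>16 * n\<close> times the squared norm of \<open>z\<close>;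
    \<open>B1\<close> and \<open>B2\<close> are the failures.\<close>
  define Q where "Q z \<omega> = (\<Sum>j<n. (\<Sum>i<m. real_of_int (z i) * A i j \<omega>)\<^sup>2)" for z \<omega>
  define B1 where "B1 z = {\<omega> \<in> space M. 16 * n * (norm z)\<^sup>2 \<le> Q z \<omega>}" for z
  define B2 where "B2 z = {\<omega> \<in> space M. Q z \<omega> \<le> n / 256 * (norm z)\<^sup>2}" for z
  define B3 where "B3 = {\<omega> \<in> space M. E \<le> (\<Sum>i<m. (max 0 ((\<Sum>j<n. A i j \<omega> * c j) - s))\<^sup>2)}"
  have fin: "finite Z" "finite Z'"
    unfolding Z_def Z'_def by (auto intro!: finite_PiE finite_Collect_conjI)
  have ev: "B1 z \<in> events" "B2 z \<in> events" "B3 \<in> events" for z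
    unfolding B1_def B2_def B3_def Q_def by measurable
  have pB: "prob (B1 z) \<le> exp (- 3 * real n)" "prob (B2 z) \<le> exp (- 2 * real n)" if z: "z \<in> Z'" for z
  proof -
    have N: "0 < norm z"
    proof -
      obtain i where "i < m" "z i \<noteq> 0" using z by (auto simp: Z'_def)
      then have "norm z \<noteq> 0" unfolding norm_def by (subst L2_set_eq_0_iff) auto
      then show ?thesis using L2_set_nonneg[of "\<lambda>i. real_of_int (z i)" "{..<m}"] unfolding norm_def by linarith
    qed
    define w where "w i = real_of_int (z i) / norm z" for i
    have G: "gaussian_family M (\<lambda>j \<omega>. \<Sum>i<m. w i * A i j \<omega>) {..<n}"
      using gaussian_matrix_columns[OF A, of w] sum_normalized_squares[of "\<lambda>i. real_of_int (z i)" "{..<m}"] N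
      by (simp add: w_def norm_def)
    have eq: "(\<Sum>j<n. (\<Sum>i<m. w i * A i j \<omega>)\<^sup>2) = Q z \<omega> / (norm z)\<^sup>2" for \<omega>
      by (simp add: w_def Q_def power_divide flip: sum_divide_distrib)
    have "16 * n \<le> Q z \<omega> / (norm z)\<^sup>2 \<longleftrightarrow> 16 * n * (norm z)\<^sup>2 \<le> Q z \<omega>" for \<omega>
      using N by (subst pos_le_divide_eq) auto
    then show "prob (B1 z) \<le> exp (- 3 * real n)"
      using gaussian_sum_squares_upper[OF G] unfolding eq B1_def by simp
    have "Q z \<omega> / (norm z)\<^sup>2 \<le> n / 256 \<longleftrightarrow> Q z \<omega> \<le> n / 256 * (norm z)\<^sup>2" for \<omega>
      using N by (subst pos_divide_le_eq) auto
    then show "prob (B2 z) \<le> exp (- 2 * real n)"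
      using gaussian_sum_squares_lower[OF G] unfolding eq B2_def by simp
  qed
  have "gaussian_family M (\<lambda>i \<omega>. \<Sum>j<n. A i j \<omega> * c j) {..<m}"
    using c by (intro gaussian_matrix_rows[OF A]) (simp flip: L2_set_power2)
  from gaussian_excess_squares[OF this _ s(1) \<alpha>, of E]
  have pB3: "prob B3 \<le> exp (m * (exp (- \<alpha> * s\<^sup>2) / sqrt (1 - 2 * \<alpha>)) - E / 4)"
    by (simp add: B3_def)
  have cZ: "real (card Z') \<le> exp (k * (2 + ln (1 + m / k)))"
  proof -
    have "card Z' \<le> card Z" using fin by (intro card_mono) (auto simp: Z'_def)
    \<comment> \<open>With \<open>t = ln (1 + m / k)\<close> the geometric factor becomes
      \<open>(1 + 2 * k / m) ^ m \<le> exp (2 * k)\<close>.\<close>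
    also have "real (card Z) \<le> exp (ln (1 + m / k) * k) * (1 + 2 / (exp (ln (1 + m / k)) - 1)) ^ card {..<m}"
      unfolding Z_def using k by (intro card_bounded_integer_vectors ln_gt_zero) auto
    also have "\<dots> \<le> exp (ln (1 + m / k) * k) * exp (2 * k)"
    proof (rule mult_left_mono)
      have "exp (ln (1 + m / k)) = 1 + m / k" using k by (intro exp_ln) (auto intro: add_pos_nonneg)
      then have "(1 + 2 / (exp (ln (1 + m / k)) - 1)) ^ card {..<m} = (1 + 2 * k / m) ^ m" by simp
      also have "\<dots> \<le> exp (2 * k / m) ^ m"
        using exp_ge_add_one_self[of "2 * k / m"] by (intro power_mono) auto
      also have "\<dots> = exp (2 * k)" using k by (simp flip: exp_of_nat_mult)
      finally show "(1 + 2 / (exp (ln (1 + m / k)) - 1)) ^ card {..<m} \<le> exp (2 * k)" .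
    qed simp
    finally show ?thesis by (simp add: algebra_simps exp_add)
  qed
  have "{\<omega> \<in> space M. lp_value m n (\<lambda>i j. A i j \<omega>) c < ereal (1 / s')} \<subseteq> (\<Union>z\<in>Z'. B1 z) \<union> (\<Union>z\<in>Z'. B2 z) \<union> B3"
  proof (rule subsetI, rule ccontr)
    fix \<omega> assume \<omega>: "\<omega> \<in> {\<omega> \<in> space M. lp_value m n (\<lambda>i j. A i j \<omega>) c < ereal (1 / s')}"
      and "\<omega> \<notin> (\<Union>z\<in>Z'. B1 z) \<union> (\<Union>z\<in>Z'. B2 z) \<union> B3"
    then have up: "\<And>z. z \<in> Z' \<Longrightarrow> Q z \<omega> \<le> 16 * n * (norm z)\<^sup>2"
      and low: "\<And>z. z \<in> Z' \<Longrightarrow> n / 256 * (norm z)\<^sup>2 \<le> Q z \<omega>"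
      and exc: "(\<Sum>i<m. (max 0 ((\<Sum>j<n. A i j \<omega> * c j) - s))\<^sup>2) \<le> E"
      by (auto simp: B1_def B2_def B3_def not_le less_imp_le)
    have norm0: "0 \<le> norm z" for z by (simp add: norm_def)
    have L2Q: "L2_set (\<lambda>j. \<Sum>i<m. real_of_int (z i) * A i j \<omega>) {..<n} = sqrt (Q z \<omega>)" for z
      by (simp add: L2_set_def Q_def)
    have up': "sqrt (Q z \<omega>) \<le> 4 * sqrt n * norm z" if "z \<in> Z'" for z
    proof -
      have "sqrt (Q z \<omega>) \<le> sqrt (16 * n * (norm z)\<^sup>2)" using up[OF that] by (rule real_sqrt_le_mono)
      then show ?thesis using norm0 by (simp add: real_sqrt_mult)
    qed
    have sqrt256: "sqrt 256 = 16" by (rule real_sqrt_unique) auto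
    have low': "sqrt n / 16 * norm z \<le> sqrt (Q z \<omega>)" if "z \<in> Z'" for z
    proof -
      have "sqrt (n / 256 * (norm z)\<^sup>2) \<le> sqrt (Q z \<omega>)" using low[OF that] by (rule real_sqrt_le_mono)
      then show ?thesis using norm0[of z] by (simp add: real_sqrt_mult real_sqrt_divide sqrt256)
    qed
    have "\<exists>j<n. (\<Sum>i<m. y i * A i j \<omega>) \<noteq> s' * c j" if y: "\<forall>i<m. 0 \<le> y i" "(\<Sum>i<m. y i) \<le> 1" for y
    proof (rule ccontr)
      assume "\<not> ?thesis"
      then have eq: "\<forall>j<n. (\<Sum>i<m. y i * A i j \<omega>) = s' * c j" by auto
      have "s' \<le> s + sqrt E * (16 * (s' + 4 * sqrt (n / k)) / sqrt n + 1 / sqrt k)"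
        using n k(1) c s(1) less_imp_le[OF s(2)] _ _ _ y eq
      proof (rule hull_multiple_bound)
        show "sqrt n / 16 * L2_set (\<lambda>i. real_of_int (z i)) {..<m} \<le> L2_set (\<lambda>j. \<Sum>i<m. real_of_int (z i) * A i j \<omega>) {..<n}"
          "L2_set (\<lambda>j. \<Sum>i<m. real_of_int (z i) * A i j \<omega>) {..<n} \<le> 4 * sqrt n * L2_set (\<lambda>i. real_of_int (z i)) {..<m}"
          if "z \<in> PiE {..<m} (\<lambda>_. {- int k..int k})" "(\<Sum>i<m. real_of_int \<bar>z i\<bar>) \<le> real k" "\<exists>i<m. z i \<noteq> 0" for z
          using low'[of z] up'[of z] that unfolding L2Q by (simp_all add: Z'_def Z_def norm_def)
        show "(\<Sum>i<m. (max 0 (inner_n n (\<lambda>j. A i j \<omega>) c - s))\<^sup>2) \<le> E"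
          using exc by (simp add: inner_n_def)
      qed
      then show False using less by simp
    qed
    then obtain x where "x \<in> lp_feasible m n (\<lambda>i j. A i j \<omega>)" "inner_n n c x = 1 / s'"
      using lp_point_if_outside_hull[OF s(2), of m n "\<lambda>i j. A i j \<omega>" c] by blast
    then have "ereal (1 / s') \<le> lp_value m n (\<lambda>i j. A i j \<omega>) c" using lp_value_ge by metis
    then show False using \<omega> by auto
  qed
  then have "prob {\<omega> \<in> space M. lp_value m n (\<lambda>i j. A i j \<omega>) c < ereal (1 / s')}
     \<le> prob ((\<Union>z\<in>Z'. B1 z) \<union> (\<Union>z\<in>Z'. B2 z) \<union> B3)"
    using ev fin by (intro finite_measure_mono sets.Un sets.finite_UN) auto
  also have "\<dots> \<le> prob ((\<Union>z\<in>Z'. B1 z) \<union> (\<Union>z\<in>Z'. B2 z)) + prob B3"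
    using ev fin by (intro measure_Un_le sets.Un sets.finite_UN) auto
  also have "prob ((\<Union>z\<in>Z'. B1 z) \<union> (\<Union>z\<in>Z'. B2 z)) \<le> prob (\<Union>z\<in>Z'. B1 z) + prob (\<Union>z\<in>Z'. B2 z)"
    using ev fin by (intro measure_Un_le sets.Un sets.finite_UN) auto
  also have "\<dots> \<le> card Z' * exp (- 3 * real n) + card Z' * exp (- 2 * real n)"
    using pB ev fin by (intro add_mono prob_UN_le) auto
  also have "\<dots> = card Z' * (exp (- 3 * real n) + exp (- 2 * real n))" by (simp add: distrib_left)
  finally have "prob {\<omega> \<in> space M. lp_value m n (\<lambda>i j. A i j \<omega>) c < ereal (1 / s')}
    \<le> card Z' * (exp (- 3 * real n) + exp (- 2 * real n)) + prob B3" by simp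
  also have "\<dots> \<le> exp (k * (2 + ln (1 + m / k))) * (exp (- 3 * real n) + exp (- 2 * real n))
       + exp (m * (exp (- \<alpha> * s\<^sup>2) / sqrt (1 - 2 * \<alpha>)) - E / 4)"
    using cZ pB3 by (intro add_mono mult_right_mono) auto
  finally show ?thesis by simp
qed

text \<open>The point \<open>c / s\<close> has value \<open>1 / s\<close> and is feasible unless
  some row reaches \<open>s\<close> on \<open>c\<close>; a union bound over the rows suffices when
  \<open>m\<close> is huge compared with \<open>n\<close>.\<close>

lemma lp_value_lower_tail_large:
  fixes A :: "nat \<Rightarrow> nat \<Rightarrow> 'a \<Rightarrow> real" and c :: "nat \<Rightarrow> real"
  assumes A: "standard_gaussian_matrix M m n A" and c: "L2_set c {..<n} = 1"
    and s: "0 < s" and \<alpha>: "0 \<le> \<alpha>" "\<alpha> < 1/2"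
  shows "prob {\<omega> \<in> space M. lp_value m n (\<lambda>i j. A i j \<omega>) c < ereal (1 / s)}
     \<le> m * (exp (- \<alpha> * s\<^sup>2) / sqrt (1 - 2 * \<alpha>))"
proof -
  have [measurable]: "\<And>i j. i < m \<Longrightarrow> j < n \<Longrightarrow> random_variable borel (A i j)"
    using gaussian_matrix_measurable[OF A] .
  have c2: "(\<Sum>j<n. (c j)\<^sup>2) = 1" using c by (simp flip: L2_set_power2)
  have "{\<omega> \<in> space M. lp_value m n (\<lambda>i j. A i j \<omega>) c < ereal (1 / s)}
    \<subseteq> {\<omega> \<in> space M. \<exists>i\<in>{..<m}. s \<le> (\<Sum>j<n. A i j \<omega> * c j)}"
  proof (rule subsetI, rule ccontr)
    fix \<omega> assume \<omega>: "\<omega> \<in> {\<omega> \<in> space M. lp_value m n (\<lambda>i j. A i j \<omega>) c < ereal (1 / s)}"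
      and "\<omega> \<notin> {\<omega> \<in> space M. \<exists>i\<in>{..<m}. s \<le> (\<Sum>j<n. A i j \<omega> * c j)}"
    then have "(\<Sum>j<n. A i j \<omega> * c j) \<le> s" if "i < m" for i using that by force
    then have "(\<lambda>j. c j / s) \<in> lp_feasible m n (\<lambda>i j. A i j \<omega>)"
      using s by (simp add: lp_feasible_def inner_n_def flip: sum_divide_distrib)
    from lp_value_ge[OF this, of c] have "ereal (1 / s) \<le> lp_value m n (\<lambda>i j. A i j \<omega>) c"
      using c2 by (simp add: inner_n_def power2_eq_square flip: sum_divide_distrib)
    then show False using \<omega> by auto
  qed
  then have "prob {\<omega> \<in> space M. lp_value m n (\<lambda>i j. A i j \<omega>) c < ereal (1 / s)}
     \<le> prob {\<omega> \<in> space M. \<exists>i\<in>{..<m}. s \<le> (\<Sum>j<n. A i j \<omega> * c j)}"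
    by (rule finite_measure_mono) measurable
  also have "\<dots> \<le> card {..<m} * (exp (- \<alpha> * s\<^sup>2) / sqrt (1 - 2 * \<alpha>))"
    using s \<alpha> by (intro gaussian_max_tail gaussian_matrix_rows[OF A c2]) auto
  finally show ?thesis by simp
qed

end

section \<open>Asymptotics\<close>

context prob_space
begin

context
  fixes m :: "nat \<Rightarrow> nat" and A :: "nat \<Rightarrow> nat \<Rightarrow> nat \<Rightarrow> 'a \<Rightarrow> real" and c :: "nat \<Rightarrow> nat \<Rightarrow> real"
    and z :: "nat \<Rightarrow> 'a \<Rightarrow> ereal" and L :: "nat \<Rightarrow> real"
  assumes ratio: "filterlim (\<lambda>n. real (m n) / real n) at_top sequentially"
    and A: "\<And>n. n \<ge> 1 \<Longrightarrow> standard_gaussian_matrix M (m n) n (A n)"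
    and c: "\<And>n. n \<ge> 1 \<Longrightarrow> L2_set (c n) {..<n} = 1"
  defines "z \<equiv> \<lambda>n \<omega>. lp_value (m n) n (\<lambda>i j. A n i j \<omega>) (c n)"
    and "L \<equiv> \<lambda>n. sqrt (2 * ln (real (m n) / real n))"
begin

lemma L_at_top: "filterlim L at_top sequentially"
proof -
  have "filterlim (\<lambda>x::real. sqrt (2 * ln x)) at_top at_top" by real_asymp
  from filterlim_compose[OF this ratio] show ?thesis by (simp add: L_def)
qed

text \<open>Writing \<open>m\<close> as \<open>n * exp (L\<^sup>2 / 2)\<close> turns the asymptotic
  conditions below into inequalities in the single variable \<open>L\<close>.\<close>

lemma eventually_m_eq:
  "eventually (\<lambda>n. 1 \<le> n \<and> n \<le> m n \<and> real (m n) = real n * exp ((L n)\<^sup>2 / 2)) sequentially"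
proof -
  have "eventually (\<lambda>n. 1 \<le> real (m n) / real n) sequentially"
    using ratio by (simp add: filterlim_at_top)
  with eventually_ge_at_top[of 1] show ?thesis
  proof eventually_elim
    case (elim n)
    then have le: "real n \<le> real (m n)" by (simp add: pos_le_divide_eq)
    have "(L n)\<^sup>2 / 2 = ln (real (m n) / real n)" using elim by (simp add: L_def)
    then have "exp ((L n)\<^sup>2 / 2) = real (m n) / real n" using elim le by simp
    then show ?case using elim le by simp
  qed
qed

lemma eventually_upper_tail:
  assumes "\<epsilon> > 0"
  shows "eventually (\<lambda>n. prob {\<omega> \<in> space M. ereal ((1 + \<epsilon>) / L n) < z n \<omega>} \<le> 2 * exp (- real n)) sequentially"
proof -
  \<comment> \<open>The thresholds are \<open>s = d * L\<close> and \<open>s1 = b * L\<close>. The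
    room \<open>d < b\<close> absorbs the rounding losses (\<open>ev1\<close>), and
    \<open>b < 1\<close> makes the expected number of exceeding rows outgrow \<open>n\<close> times
    the logarithm of the grid size (\<open>ev2\<close>).\<close>
  define b where "b = 1 / (1 + \<epsilon> / 2)"
  define d where "d = 1 / (1 + \<epsilon>)"
  have bd: "0 < b" "b < 1" "d < b" "0 < d" using assms by (auto simp: b_def d_def field_simps)
  have b2: "b\<^sup>2 < 1" using bd by (simp add: power_less_one_iff abs_square_less_1)
  have ev1: "eventually (\<lambda>L. d * L \<le> b * L * (1 - exp (- (L\<^sup>2) / 4)) -
      4 * exp (- (L\<^sup>2) / 4) * sqrt (12 / exp (- (b * L + 1)\<^sup>2 / 2))) at_top"
    using bd b2 by real_asymp
  have ev2: "eventually (\<lambda>L. 2 + ln (1 + 4 / exp (- (L\<^sup>2) / 4)) \<le> exp (L\<^sup>2 / 2) * (exp (- (b * L + 1)\<^sup>2 / 2) / 12)) at_top"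
    using bd b2 by real_asymp
  from eventually_compose_filterlim[OF ev1 L_at_top] eventually_compose_filterlim[OF ev2 L_at_top]
    eventually_compose_filterlim[OF eventually_gt_at_top[of 0] L_at_top] eventually_m_eq
  show ?thesis
  proof eventually_elim
    case (elim n)
    define \<theta> where "\<theta> = exp (- ((L n)\<^sup>2) / 4)"
    define q where "q = exp (- (b * L n + 1)\<^sup>2 / 2) / 6"
    have n: "1 \<le> n" "0 < n" "n \<le> m n" "real (m n) = real n * exp ((L n)\<^sup>2 / 2)" "0 < L n" using elim by auto
    have \<theta>: "0 < \<theta>" "\<theta> < 1" using n by (auto simp: \<theta>_def)
    have q: "0 < q" by (simp add: q_def)
    have "m n / (m n * q / 2) = 12 / exp (- (b * L n + 1)\<^sup>2 / 2)" using n q by (simp add: q_def)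
    then have "d * L n \<le> b * L n * (1 - \<theta>) - 4 * \<theta> * sqrt (m n / (m n * q / 2))"
      using elim(1) by (simp add: \<theta>_def)
    \<comment> \<open>The count \<open>K = m n * q / 2\<close> is half the rate in the counting
      bound, leaving the exponent \<open>- (m n * q / 2)\<close>.\<close>
    then have "prob {\<omega> \<in> space M. ereal (1 / (d * L n)) < z n \<omega>}
       \<le> (exp 1 * (1 + 4 / \<theta>)) ^ n * exp (m n * q / 2 - m n * (exp (- (b * L n + 1)\<^sup>2 / 2) / 6)) + 2 ^ n * exp (- 3 * real (m n))"
      unfolding z_def using n bd q \<theta> by (intro lp_value_upper_tail A c) auto
    also have "1 / (d * L n) = (1 + \<epsilon>) / L n" by (simp add: d_def)
    also have "m n * q / 2 - m n * (exp (- (b * L n + 1)\<^sup>2 / 2) / 6) = - (m n * q / 2)"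
      by (simp add: q_def)
    also have "(exp 1 * (1 + 4 / \<theta>)) ^ n = exp (n * (1 + ln (1 + 4 / \<theta>)))"
      using \<theta> by (simp add: exp_of_nat_mult exp_add add_pos_pos)
    also have "exp (n * (1 + ln (1 + 4 / \<theta>))) * exp (- (m n * q / 2)) = exp (n * (1 + ln (1 + 4 / \<theta>)) - m n * q / 2)"
      by (simp flip: exp_add)
    finally have "prob {\<omega> \<in> space M. ereal ((1 + \<epsilon>) / L n) < z n \<omega>}
       \<le> exp (n * (1 + ln (1 + 4 / \<theta>)) - m n * q / 2) + 2 ^ n * exp (- 3 * real (m n))" .
    also have "\<dots> \<le> exp (- real n) + exp (- real n)"
    proof (rule add_mono)
      have "real n * (2 + ln (1 + 4 / \<theta>)) \<le> real n * (exp ((L n)\<^sup>2 / 2) * (exp (- (b * L n + 1)\<^sup>2 / 2) / 12))"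
        using elim(2) by (intro mult_left_mono) (auto simp: \<theta>_def)
      also have "\<dots> = m n * q / 2" by (simp add: n q_def)
      finally show "exp (n * (1 + ln (1 + 4 / \<theta>)) - m n * q / 2) \<le> exp (- real n)" by (simp add: algebra_simps)
      have "(2::real) ^ n \<le> exp 1 ^ n" using exp_ge_add_one_self[of 1] by (intro power_mono) auto
      then have "2 ^ n * exp (- 3 * real (m n)) \<le> exp n * exp (- 3 * real (m n))"
        by (intro mult_right_mono) (auto simp flip: exp_of_nat_mult)
      also have "\<dots> \<le> exp (- real n)" using n(3) by (simp flip: exp_add)
      finally show "2 ^ n * exp (- 3 * real (m n)) \<le> exp (- real n)" by simp
    qed
    finally show ?case by simp
  qed
qed

text \<open>The bound adds up two regimes. If \<open>(L n)\<^sup>2 \<le> n\<close>, the lattice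
  argument gives the first two terms; otherwise the plain union bound over rows gives the
  third.\<close>

lemma eventually_lower_tail:
  assumes \<epsilon>: "0 < \<epsilon>" "\<epsilon> \<le> 1/2"
  shows "eventually (\<lambda>n. prob {\<omega> \<in> space M. z n \<omega> < ereal (1 / ((1 + \<epsilon>) * L n))}
    \<le> 2 * exp (- real n) + exp (- ((\<epsilon> / 300)\<^sup>2 / 8 * real n)) + real n * exp (- (\<epsilon> / 2 * real n)) / sqrt (1 - 1 / (1 + \<epsilon>))) sequentially"
proof -
  define b where "b = 1 + \<epsilon> / 2"
  define C where "C = 1 / sqrt (1 - 1 / b)"
  have b: "1 < b" "b \<le> 2" using \<epsilon> by (auto simp: b_def)
  have C: "0 < C" using b by (simp add: C_def)
  have \<delta>: "0 < (\<epsilon> / 300)\<^sup>2 / 8" using \<epsilon> by simp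
  have ev1: "eventually (\<lambda>L::real. 2 + ln (1 + 2 * L\<^sup>2 * exp (L\<^sup>2 / 2)) \<le> L\<^sup>2) at_top"
    by real_asymp
  have ev2: "eventually (\<lambda>L::real. exp (L\<^sup>2 / 2) * (exp (- (b * L\<^sup>2 / 2)) * C) \<le> (\<epsilon> / 300)\<^sup>2 / 8) at_top"
    using b C \<delta> by real_asymp
  from eventually_compose_filterlim[OF ev1 L_at_top] eventually_compose_filterlim[OF ev2 L_at_top]
    eventually_compose_filterlim[OF eventually_gt_at_top[of 0] L_at_top] eventually_m_eq
  show ?thesis
  proof eventually_elim
    case (elim n)
    have n: "1 \<le> n" "0 < n" "n \<le> m n" "0 < m n" "real (m n) = real n * exp ((L n)\<^sup>2 / 2)" "0 < L n" using elim by auto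
    have \<epsilon>1: "0 < 1 - 1 / (1 + \<epsilon>)" using \<epsilon> by simp
    show ?case
    proof (cases "(L n)\<^sup>2 \<le> n")
      case True
      \<comment> \<open>This \<open>k\<close> is small enough for the lattice count to be at most
        \<open>exp n\<close> (\<open>ev1\<close>), and large enough that
        \<open>n / k \<le> 2 * (L n)\<^sup>2\<close>, since rounding down a number at least 1 loses
        at most a factor 2.\<close>
      define k where "k = nat \<lfloor>n / (L n)\<^sup>2\<rfloor>"
      have "1 \<le> n / (L n)\<^sup>2" using True n by simp
      then have k: "0 < k" "real k \<le> n / (L n)\<^sup>2" "n / (L n)\<^sup>2 < real k + 1"
        unfolding k_def by linarith+
      then have "n / (L n)\<^sup>2 \<le> 2 * real k" by linarith
      then have nk: "n / k \<le> 2 * (L n)\<^sup>2" using k n by (simp add: field_simps)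
      define r where "r = sqrt (n / k)"
      have "(3 / 2 * L n)\<^sup>2 = 9 / 4 * (L n)\<^sup>2" by (simp add: power_mult_distrib power2_eq_square)
      then have "n / k \<le> (3 / 2 * L n)\<^sup>2" using nk zero_le_power2[of "L n"] by linarith
      then have "r \<le> sqrt ((3 / 2 * L n)\<^sup>2)"
        unfolding r_def by (rule real_sqrt_le_mono)
      then have r: "r \<le> 3 / 2 * L n" using n by simp
      \<comment> \<open>The constant 300 makes the error small: with \<open>r\<close> and
        \<open>(1 + \<epsilon>) * L n\<close> at most \<open>3/2 * L n\<close>, the bracket is at
        most \<open>121.5 * L n < 150 * L n\<close>, and \<open>\<epsilon> / 300 * 150\<close> is
        the gap \<open>\<epsilon> / 2\<close> between \<open>1 + \<epsilon>\<close> and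
        \<open>b\<close>.\<close>
      define E where "E = (\<epsilon> / 300)\<^sup>2 * n"
      have sE: "sqrt E = \<epsilon> / 300 * sqrt n" using \<epsilon> by (simp add: E_def real_sqrt_mult)
      have "sqrt E * (16 * ((1 + \<epsilon>) * L n + 4 * sqrt (n / k)) / sqrt n + 1 / sqrt k) = \<epsilon> / 300 * (16 * ((1 + \<epsilon>) * L n) + 65 * r)"
        unfolding sE r_def using n k by (simp add: real_sqrt_divide field_simps)
      also have "\<dots> < \<epsilon> / 300 * (150 * L n)"
      proof (rule mult_strict_left_mono)
        have "(1 + \<epsilon>) * L n \<le> 3 / 2 * L n" using \<epsilon> n by (intro mult_right_mono) auto
        then show "16 * ((1 + \<epsilon>) * L n) + 65 * r < 150 * L n" using r n by linarith
      qed (use \<epsilon> in simp)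
      also have "\<dots> = (1 + \<epsilon>) * L n - b * L n" by (simp add: b_def algebra_simps)
      finally have less: "b * L n + sqrt E * (16 * ((1 + \<epsilon>) * L n + 4 * sqrt (n / k)) / sqrt n + 1 / sqrt k) < (1 + \<epsilon>) * L n"
        by linarith
      \<comment> \<open>With \<open>\<alpha> = 1 / (2 * b)\<close> and \<open>s = b * L n\<close>
        the exponent \<open>\<alpha> * s\<^sup>2\<close> is \<open>b * (L n)\<^sup>2 / 2\<close>,
        which beats the growth of \<open>m n\<close> as \<open>b > 1\<close>. By \<open>ev2\<close>
        the resulting term is at most half of \<open>E / 4\<close>.\<close>
      have "prob {\<omega> \<in> space M. z n \<omega> < ereal (1 / ((1 + \<epsilon>) * L n))}
        \<le> exp (k * (2 + ln (1 + m n / k))) * (exp (- 3 * real n) + exp (- 2 * real n))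
         + exp (m n * (exp (- (1 / (2 * b)) * (b * L n)\<^sup>2) / sqrt (1 - 2 * (1 / (2 * b)))) - E / 4)"
        unfolding z_def
      proof (rule lp_value_lower_tail_moderate[OF A[OF n(1)] c[OF n(1)] n(2) k(1) n(4)])
        show "0 < (1 + \<epsilon>) * L n" using n \<epsilon> by simp
        show "1 / 4 \<le> 1 / (2 * b)" "1 / (2 * b) < 1 / 2" using b by (auto simp: field_simps)
      qed (use n b less in auto)
      also have "\<dots> \<le> 2 * exp (- real n) + exp (- ((\<epsilon> / 300)\<^sup>2 / 8 * real n))"
      proof (rule add_mono)
        have "m n / k = exp ((L n)\<^sup>2 / 2) * (n / k)" by (simp add: n)
        also have "\<dots> \<le> exp ((L n)\<^sup>2 / 2) * (2 * (L n)\<^sup>2)" using nk by (intro mult_left_mono) auto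
        finally have "ln (1 + m n / k) \<le> ln (1 + 2 * (L n)\<^sup>2 * exp ((L n)\<^sup>2 / 2))"
          by (intro ln_mono) (auto simp: mult_ac intro: add_pos_nonneg)
        then have "k * (2 + ln (1 + m n / k)) \<le> (n / (L n)\<^sup>2) * (L n)\<^sup>2"
          using k elim(1) by (intro mult_mono) auto
        then have "k * (2 + ln (1 + m n / k)) \<le> n" using n by simp
        then have "exp (k * (2 + ln (1 + m n / k))) * (exp (- 3 * real n) + exp (- 2 * real n)) \<le> exp n * (exp (- 2 * real n) + exp (- 2 * real n))"
          by (intro mult_mono add_mono) auto
        also have "\<dots> = 2 * exp (- real n)" by (simp flip: exp_add)
        finally show "exp (k * (2 + ln (1 + m n / k))) * (exp (- 3 * real n) + exp (- 2 * real n)) \<le> 2 * exp (- real n)" .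
        have "(1 / (2 * b)) * (b * L n)\<^sup>2 = b * (L n)\<^sup>2 / 2" using b by (simp add: power2_eq_square)
        then have "m n * (exp (- (1 / (2 * b)) * (b * L n)\<^sup>2) / sqrt (1 - 2 * (1 / (2 * b))))
          = n * (exp ((L n)\<^sup>2 / 2) * (exp (- (b * (L n)\<^sup>2 / 2)) * C))"
          by (simp add: n C_def)
        also have "\<dots> \<le> n * ((\<epsilon> / 300)\<^sup>2 / 8)" using elim(2) by (intro mult_left_mono) auto
        finally show "exp (m n * (exp (- (1 / (2 * b)) * (b * L n)\<^sup>2) / sqrt (1 - 2 * (1 / (2 * b)))) - E / 4)
          \<le> exp (- ((\<epsilon> / 300)\<^sup>2 / 8 * real n))"
          unfolding E_def by (simp add: algebra_simps)
      qed
      also have "\<dots> \<le> \<dots> + real n * exp (- (\<epsilon> / 2 * real n)) / sqrt (1 - 1 / (1 + \<epsilon>))"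
        using \<epsilon>1 by simp
      finally show ?thesis .
    next
      case False
      \<comment> \<open>There is no admissible \<open>k \<ge> 1\<close>, but \<open>m\<close> is so large that already \<open>c / s'\<close> is feasible.\<close>
      have "prob {\<omega> \<in> space M. z n \<omega> < ereal (1 / ((1 + \<epsilon>) * L n))}
        \<le> m n * (exp (- (1 / (2 * (1 + \<epsilon>))) * ((1 + \<epsilon>) * L n)\<^sup>2) / sqrt (1 - 2 * (1 / (2 * (1 + \<epsilon>)))))"
        unfolding z_def using n \<epsilon> by (intro lp_value_lower_tail_large A c) auto
      also have "\<dots> = n * exp (- (\<epsilon> / 2 * (L n)\<^sup>2)) / sqrt (1 - 1 / (1 + \<epsilon>))"
      proof -
        have "(1 / (2 * (1 + \<epsilon>))) * ((1 + \<epsilon>) * L n)\<^sup>2 = (L n)\<^sup>2 / 2 + \<epsilon> / 2 * (L n)\<^sup>2"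
          using \<epsilon> by (simp add: power2_eq_square field_simps)
        moreover have "2 * (1 / (2 * (1 + \<epsilon>))) = 1 / (1 + \<epsilon>)" using \<epsilon> by (simp add: field_simps)
        moreover have "real n * exp ((L n)\<^sup>2 / 2) * exp (- ((L n)\<^sup>2 / 2 + \<epsilon> / 2 * (L n)\<^sup>2)) = n * exp (- (\<epsilon> / 2 * (L n)\<^sup>2))"
          by (simp add: mult.assoc flip: exp_add)
        ultimately show ?thesis unfolding n(5) mult_minus_left by simp
      qed
      also have "\<dots> \<le> n * exp (- (\<epsilon> / 2 * n)) / sqrt (1 - 1 / (1 + \<epsilon>))"
        using False \<epsilon> \<epsilon>1 by (intro divide_right_mono mult_left_mono) auto
      also have "\<dots> \<le> 2 * exp (- real n) + exp (- ((\<epsilon> / 300)\<^sup>2 / 8 * real n)) + \<dots>" by simp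
      finally show ?thesis .
    qed
  qed
qed

lemma superpoly_concentration:
  assumes \<epsilon>: "\<epsilon> > 0"
  shows "superpoly_likely M (\<lambda>n. {\<omega> \<in> space M. ereal (1 - \<epsilon>) \<le> ereal (L n) * z n \<omega> \<and> ereal (L n) * z n \<omega> \<le> ereal (1 + \<epsilon>)})"
  unfolding superpoly_likely_def
proof (intro allI impI)
  fix C :: real assume "C > 0"
  \<comment> \<open>Shrinking the tolerance shrinks the event, and the lower tail is available up to
    \<open>1/2\<close>.\<close>
  define e where "e = min \<epsilon> (1/2)"
  have e: "0 < e" "e \<le> 1/2" "e \<le> \<epsilon>" using \<epsilon> by (auto simp: e_def)
  define D where "D = 1 / sqrt (1 - 1 / (1 + e))"
  have D: "D > 0" using e by (simp add: D_def)
  define a where "a = (e / 300)\<^sup>2 / 8"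
  have a: "a > 0" using e by (simp add: a_def)
  \<comment> \<open>The factor 4 collects \<open>2 * exp (- real n)\<close> from each of the two
    tails.\<close>
  have "eventually (\<lambda>n. 4 * exp (- real n) \<le> real n powr (- C) / 3) sequentially"
    by real_asymp
  moreover have "eventually (\<lambda>n. exp (- (a * real n)) \<le> real n powr (- C) / 3) sequentially"
    using a by real_asymp
  moreover have "eventually (\<lambda>n. real n * exp (- (e / 2 * real n)) * D \<le> real n powr (- C) / 3) sequentially"
    using D e(1) by real_asymp
  ultimately have "eventually (\<lambda>n. 4 * exp (- real n) + exp (- (a * real n)) + real n * exp (- (e / 2 * real n)) * D \<le> real n powr (- C)) sequentially"
    by eventually_elim simp
  with eventually_upper_tail[OF e(1)] eventually_lower_tail[OF e(1,2)]
    eventually_compose_filterlim[OF eventually_gt_at_top[of 0] L_at_top] eventually_ge_at_top[of 1]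
  have "eventually (\<lambda>n. prob {\<omega> \<in> space M. ereal (1 - \<epsilon>) \<le> ereal (L n) * z n \<omega> \<and> ereal (L n) * z n \<omega> \<le> ereal (1 + \<epsilon>)}
     \<ge> 1 - real n powr (- C)) sequentially"
  proof eventually_elim
    case (elim n)
    have [measurable]: "\<And>i j. i < m n \<Longrightarrow> j < n \<Longrightarrow> random_variable borel (A n i j)"
      using gaussian_matrix_measurable[OF A[OF elim(4)]] .
    have [measurable]: "z n \<in> borel_measurable M"
      unfolding z_def by (rule borel_measurable_lp_value) measurable
    let ?G = "{\<omega> \<in> space M. ereal (1 - \<epsilon>) \<le> ereal (L n) * z n \<omega> \<and> ereal (L n) * z n \<omega> \<le> ereal (1 + \<epsilon>)}"
    let ?U = "{\<omega> \<in> space M. ereal ((1 + e) / L n) < z n \<omega>}"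
    let ?V = "{\<omega> \<in> space M. z n \<omega> < ereal (1 / ((1 + e) * L n))}"
    have "space M - ?G \<subseteq> ?U \<union> ?V"
    proof (rule subsetI, rule ccontr)
      fix \<omega> assume \<omega>: "\<omega> \<in> space M - ?G" "\<omega> \<notin> ?U \<union> ?V"
      then have le: "z n \<omega> \<le> ereal ((1 + e) / L n)" and ge: "ereal (1 / ((1 + e) * L n)) \<le> z n \<omega>" by auto
      \<comment> \<open>Both bounds are finite, so the value is a real number off the two tail
        events.\<close>
      from le ge obtain x where x: "z n \<omega> = ereal x" by (cases "z n \<omega>") auto
      have "L n * x \<le> 1 + e" using le elim(3) unfolding x by (simp add: pos_le_divide_eq mult.commute)
      moreover have "1 / (1 + e) \<le> L n * x"
      proof -
        have "1 / (1 + e) = L n * (1 / ((1 + e) * L n))" using elim(3) by simp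
        also have "\<dots> \<le> L n * x" using ge elim(3) unfolding x by (intro mult_left_mono) auto
        finally show ?thesis .
      qed
      moreover have "1 - e \<le> 1 / (1 + e)" using e by (simp add: field_simps)
      ultimately have "\<omega> \<in> ?G" using \<omega> e x by auto
      then show False using \<omega> by auto
    qed
    then have "prob (space M - ?G) \<le> prob (?U \<union> ?V)" by (intro finite_measure_mono) measurable
    also have "\<dots> \<le> prob ?U + prob ?V" by (intro measure_Un_le) measurable
    also have "\<dots> \<le> real n powr (- C)" using elim(1,2,5) by (simp add: a_def D_def)
    finally have "prob (space M - ?G) \<le> real n powr (- C)" .
    moreover have "prob (space M - ?G) = 1 - prob ?G" by (intro prob_compl) measurable
    ultimately show ?case by simp
  qed
  then show "\<exists>n0. \<forall>n\<ge>n0. 1 - real n powr (- C) \<le>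
      prob {\<omega> \<in> space M. ereal (1 - \<epsilon>) \<le> ereal (L n) * z n \<omega> \<and> ereal (L n) * z n \<omega> \<le> ereal (1 + \<epsilon>)}"
    by (simp add: eventually_sequentially)
qed

end

text \<open>Borel-Cantelli: with exponent \<open>C = 2\<close> the complements have summable
  probabilities.\<close>

lemma superpoly_likely_imp_AE_eventually:
  assumes E: "superpoly_likely M E" and ev: "\<And>n. n \<ge> 1 \<Longrightarrow> E n \<in> events"
  shows "AE \<omega> in M. eventually (\<lambda>n. \<omega> \<in> E n) sequentially"
proof -
  obtain n0 where n0: "\<And>n. n \<ge> n0 \<Longrightarrow> prob (E n) \<ge> 1 - real n powr (- 2)"
    using E unfolding superpoly_likely_def by (meson zero_less_numeral)
  \<comment> \<open>The index 0, for which nothing is known about \<open>E\<close>, gets the empty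
    set, so that every \<open>F n\<close> is an event.\<close>
  define F where "F n = (if n \<ge> 1 then space M - E n else {})" for n
  have F: "F n \<in> events" for n using ev by (auto simp: F_def)
  have "summable (\<lambda>n. prob (F n))"
  proof (rule summable_comparison_test_ev)
    show "eventually (\<lambda>n. norm (prob (F n)) \<le> real n powr (- 2)) sequentially"
      using eventually_ge_at_top[of "max 1 n0"]
    proof eventually_elim
      case (elim n)
      then have "prob (F n) = 1 - prob (E n)" using prob_compl[OF ev[of n]] by (simp add: F_def)
      then show ?case using n0[of n] elim by simp
    qed
    show "summable (\<lambda>n. real n powr (- 2))" by (simp add: summable_real_powr_iff)
  qed
  then have "AE \<omega> in M. eventually (\<lambda>n. \<omega> \<in> space M - F n) sequentially"
    using F by (intro borel_cantelli_AE1) (auto simp: emeasure_eq_measure)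
  then show ?thesis
  proof eventually_elim
    case (elim \<omega>)
    from elim eventually_ge_at_top[of 1] show ?case
      by eventually_elim (auto simp: F_def)
  qed
qed

end

theorem theorem1p3:
  fixes M :: "'w measure"
    and m :: "nat \<Rightarrow> nat"
    and A :: "nat \<Rightarrow> nat \<Rightarrow> nat \<Rightarrow> 'w \<Rightarrow> real"
    and c :: "nat \<Rightarrow> nat \<Rightarrow> real"
    and z :: "nat \<Rightarrow> 'w \<Rightarrow> ereal"
  assumes "prob_space M"
    and "\<And>n. n \<ge> 1 \<Longrightarrow> m n > 0"
    and "filterlim (\<lambda>n. real (m n) / real n) at_top sequentially"
    and "\<And>n. n \<ge> 1 \<Longrightarrow> standard_gaussian_matrix M (m n) n (A n)"
    and "\<And>n. n \<ge> 1 \<Longrightarrow> L2_set (c n) {..<n} = 1"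
  defines "z \<equiv> \<lambda>n \<omega>. lp_value (m n) n (\<lambda>i j. A n i j \<omega>) (c n)"
  shows "(\<forall>\<epsilon>::real. \<epsilon> > 0 \<longrightarrow>
            superpoly_likely M (\<lambda>n. {\<omega> \<in> space M.
               ereal (1 - \<epsilon>) \<le> ereal (sqrt (2 * ln (real (m n) / real n))) * z n \<omega> \<and>
               ereal (sqrt (2 * ln (real (m n) / real n))) * z n \<omega> \<le> ereal (1 + \<epsilon>)})) \<and>
         (AE \<omega> in M. (\<lambda>n. ereal (sqrt (2 * ln (real (m n) / real n))) * z n \<omega>) \<longlonglongrightarrow> 1)"
proof -
  interpret prob_space M by fact
  define L where "L n = sqrt (2 * ln (real (m n) / real n))" for n
  let ?E = "\<lambda>\<epsilon> n. {\<omega> \<in> space M. ereal (1 - \<epsilon>) \<le> ereal (L n) * z n \<omega> \<and> ereal (L n) * z n \<omega> \<le> ereal (1 + \<epsilon>)}"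
  have likely: "superpoly_likely M (?E \<epsilon>)" if "\<epsilon> > 0" for \<epsilon>
    unfolding z_def L_def using assms(3-5) that by (rule superpoly_concentration)
  have ev: "?E \<epsilon> n \<in> events" if "n \<ge> 1" for \<epsilon> n
  proof -
    have [measurable]: "\<And>i j. i < m n \<Longrightarrow> j < n \<Longrightarrow> random_variable borel (A n i j)"
      using gaussian_matrix_measurable[OF assms(4)[OF that]] .
    have [measurable]: "z n \<in> borel_measurable M"
      unfolding z_def by (rule borel_measurable_lp_value) measurable
    show ?thesis by measurable
  qed
  \<comment> \<open>Only the countably many tolerances \<open>1 / Suc k\<close> are used, so one
    null set serves them all; since they tend to 0, this already forces convergence in the order
    topology.\<close>
  have "AE \<omega> in M. \<forall>k. eventually (\<lambda>n. \<omega> \<in> ?E (1 / real (Suc k)) n) sequentially"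
    unfolding AE_all_countable using likely ev by (intro allI superpoly_likely_imp_AE_eventually) auto
  then have "AE \<omega> in M. (\<lambda>n. ereal (L n) * z n \<omega>) \<longlonglongrightarrow> 1"
  proof eventually_elim
    case (elim \<omega>)
    show ?case
    proof (rule order_tendstoI)
      fix a :: ereal assume "a < 1"
      then obtain x where x: "a < ereal x" "x < 1" using ereal_dense2[of a 1] by (auto simp: one_ereal_def)
      obtain k where k: "1 / real (Suc k) < 1 - x"
        using reals_Archimedean[of "1 - x"] x by (auto simp: inverse_eq_divide)
      have "eventually (\<lambda>n. \<omega> \<in> ?E (1 / real (Suc k)) n) sequentially" using elim by blast
      then show "eventually (\<lambda>n. a < ereal (L n) * z n \<omega>) sequentially"
      proof eventually_elim
        case (elim n)
        have "a < ereal (1 - 1 / real (Suc k))" using x(1) k by (intro less_le_trans[OF x(1)]) simp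
        then show ?case using elim by (auto intro: less_le_trans)
      qed
    next
      fix a :: ereal assume "1 < a"
      then obtain x where x: "ereal x < a" "1 < x" using ereal_dense2[of 1 a] by (auto simp: one_ereal_def)
      obtain k where k: "1 / real (Suc k) < x - 1"
        using reals_Archimedean[of "x - 1"] x by (auto simp: inverse_eq_divide)
      have "eventually (\<lambda>n. \<omega> \<in> ?E (1 / real (Suc k)) n) sequentially" using elim by blast
      then show "eventually (\<lambda>n. ereal (L n) * z n \<omega> < a) sequentially"
      proof eventually_elim
        case (elim n)
        have "ereal (1 + 1 / real (Suc k)) < a" using x(1) k by (intro le_less_trans[OF _ x(1)]) simp
        then show ?case using elim by (auto intro: le_less_trans)
      qed
    qed
  qed
  with likely show ?thesis unfolding L_def by blast
qed

end
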